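(* Let $v_n$ be the maximum expected length of an increasing subsequence that can be selected by an online (non-anticipating) policy from $n$ independent random variables uniformly distributed on $[0,1]$. Let $\hat v_n$ be the expected length of the increasing subsequence selected from these $n$ items by the following state-dependent policy: if $z$ is the last item selected so far ($z=0$ if nothing has been selected yet), then the $k$th-to-last item, with value $x$, is accepted if and only if $$0<\frac{x-z}{1-z}\le\sqrt{\frac{2}{k(1-z)}}.$$ Then this policy is within a constant of optimality, uniformly in $n$: $$\sup_{n\ge 1}\,(v_n-\hat v_n)<\infty .$$
   Context: Online selection problem with fixed sample size $n$: items $X_1,\dots,X_n$, i.i.d. uniform on $[0,1]$, are observed one at a time. At time $i$, upon observing $X_i$, the decision maker must irrevocably accept or reject $X_i$, using only the information in $X_1,\dots,X_i$; the accepted items must form an increasing sequence. Formally, a policy is a sequence of stopping times $\tau_1<\tau_2<\cdots$ (with value $\infty$ if no further selection is made) with respect to the filtration generated by $X_1,\dots,X_n$, such that $X_{\tau_1}<X_{\tau_2}<\cdots$ along the finite stopping times. The length of the selected subsequence is $\max\{j:\tau_j\le n\}$ (and $0$ if no item is selected), and $v_n$ is the maximum of its expectation over all policies. The $k$th-to-last item is $X_{n-k+1}$ (so $X_n$ is the case $k=1$). For $z\in[0,1]$ let $v_k(z)$ be the maximum expected length in the problem with $k$ items when only items bigger than $z$ may be selected, so that $v_n=v_n(0)$. It is known that these functions are determined by the dynamic programming recursion $$v_k(z)=z\,v_{k-1}(z)+\int_z^1\max\{v_{k-1}(x)+1,\;v_{k-1}(z)\}\,\mathrm{d}x,\qquad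 k\ge 1,\qquad v_0(z)=0.$$ *)

theory Defs
  imports "HOL-Probability.Probability" "HOL-Library.Extended_Nat"
begin

text \<open>The \<open>\<sigma>\<close>-algebra at time \<open>t\<close> is generated by the items \<open>X 1, \<dots>, X n\<close> with index at most
  \<open>t\<close>; the time axis is \<^typ>\<open>enat\<close> because stopping times may take the value \<open>\<infinity>\<close>.\<close>

definition item_filtration ::
  "'a measure \<Rightarrow> (nat \<Rightarrow> 'a \<Rightarrow> real) \<Rightarrow> nat \<Rightarrow> enat \<Rightarrow> 'a measure" where
  "item_filtration M X n t =
     sigma (space M) {X i -` A \<inter> space M | i A. i \<in> {1..n} \<and> enat i \<le> t \<and> A \<in> sets borel}"

text \<open>\<open>\<tau> j\<close>, for \<open>j \<ge> 1\<close>, is the time of the \<open>j\<close>-th selection; \<open>\<tau> 0\<close> is irrelevant. The relation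
  \<open>\<tau>\<^sub>j < \<tau>\<^sub>j\<^sub>+\<^sub>1\<close> is read with the convention that \<open>\<tau>\<^sub>j = \<infinity>\<close> forces \<open>\<tau>\<^sub>j\<^sub>+\<^sub>1 = \<infinity>\<close>.\<close>

definition online_policy ::
  "'a measure \<Rightarrow> (nat \<Rightarrow> 'a \<Rightarrow> real) \<Rightarrow> nat \<Rightarrow> (nat \<Rightarrow> 'a \<Rightarrow> enat) \<Rightarrow> bool" where
  "online_policy M X n \<tau> \<longleftrightarrow>
     (\<forall>j\<ge>1. stopping_time (item_filtration M X n) (\<tau> j)) \<and>
     (\<forall>j\<ge>1. \<forall>\<omega>\<in>space M.
        \<tau> j \<omega> \<in> insert \<infinity> (enat ` {1..n}) \<and>
        (\<tau> j \<omega> < \<tau> (Suc j) \<omega> \<or> \<tau> j \<omega> = \<infinity> \<and> \<tau> (Suc j) \<omega> = \<infinity>) \<and>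
        (\<tau> (Suc j) \<omega> \<noteq> \<infinity> \<longrightarrow> X (the_enat (\<tau> j \<omega>)) \<omega> < X (the_enat (\<tau> (Suc j) \<omega>)) \<omega>))"

definition selected_length :: "nat \<Rightarrow> (nat \<Rightarrow> 'a \<Rightarrow> enat) \<Rightarrow> 'a \<Rightarrow> nat" where
  "selected_length n \<tau> \<omega> = Max (insert 0 {j. 1 \<le> j \<and> \<tau> j \<omega> \<le> enat n})"

definition optimal_value :: "'a measure \<Rightarrow> (nat \<Rightarrow> 'a \<Rightarrow> real) \<Rightarrow> nat \<Rightarrow> real" where
  "optimal_value M X n =
     (SUP \<tau>\<in>{\<tau>. online_policy M X n \<tau>}. \<integral>\<omega>. real (selected_length n \<tau> \<omega>) \<partial>M)"

text \<open>Acceptance of the \<open>k\<close>-th-to-last item with value \<open>x\<close> when \<open>z\<close> is the last selected item.\<close>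

definition accepts :: "nat \<Rightarrow> real \<Rightarrow> real \<Rightarrow> bool" where
  "accepts k z x \<longleftrightarrow>
     0 < (x - z) / (1 - z) \<and> (x - z) / (1 - z) \<le> sqrt (2 / (real k * (1 - z)))"

text \<open>\<open>last_selected n x i\<close> is the last item selected among the first \<open>i\<close> of the \<open>n\<close> items
  \<open>x 1, \<dots>, x n\<close>. Item \<open>Suc i\<close> is the \<open>(n - i)\<close>-th-to-last one.\<close>

primrec last_selected :: "nat \<Rightarrow> (nat \<Rightarrow> real) \<Rightarrow> nat \<Rightarrow> real" where
  "last_selected n x 0 = 0"
| "last_selected n x (Suc i) =
     (if accepts (n - i) (last_selected n x i) (x (Suc i)) then x (Suc i)
      else last_selected n x i)"

definition heuristic_length :: "nat \<Rightarrow> (nat \<Rightarrow> real) \<Rightarrow> nat" where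
  "heuristic_length n x =
     card {i. i < n \<and> accepts (n - i) (last_selected n x i) (x (Suc i))}"

definition heuristic_value :: "'a measure \<Rightarrow> (nat \<Rightarrow> 'a \<Rightarrow> real) \<Rightarrow> nat \<Rightarrow> real" where
  "heuristic_value M X n = (\<integral>\<omega>. real (heuristic_length n (\<lambda>i. X i \<omega>)) \<partial>M)"

end

(* In terms of \<open>p = sqrt (2 k (1 - z))\<close>, the dynamic programming recursion has the
   approximate solution \<open>p - ln p / 6\<close>. For large \<open>p\<close> a correction \<open>c / p\<close> changes the residual
   by a term of order \<open>c / p\<close> with a definite sign, which dominates all neglected terms for
   \<open>c = -1\<close> and \<open>c = 1\<close>: the former gives a supersolution of the recursion for the optimal
   value, the latter a subsolution of the recursion for the heuristic policy, and truncation at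
   small \<open>p\<close> costs additive constants only. Along any policy, the number of selected items plus the
   supersolution at the current state is a supermartingale; along the heuristic policy the same
   expression with the subsolution is a submartingale. Hence the two values differ by a bounded
   amount. *)

theory Submission
  imports Defs "HOL-Real_Asymp.Real_Asymp"
begin

section \<open>The uniform distribution on the unit interval\<close>

abbreviation (input) unit_uniform :: "real measure" where
  "unit_uniform \<equiv> uniform_measure lborel {0..1}"

definition bounded_measurable :: "(real \<Rightarrow> real) \<Rightarrow> bool" where
  "bounded_measurable f \<longleftrightarrow> f \<in> borel_measurable borel \<and> bounded (f ` {0..1})"

lemma bounded_measurableI:
  assumes "f \<in> borel_measurable borel" "\<And>x. x \<in> {0..1} \<Longrightarrow> \<bar>f x\<bar> \<le> B"
  shows "bounded_measurable f"
  using assms unfolding bounded_measurable_def bounded_iff by fastforce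

lemma bounded_measurableD:
  assumes "bounded_measurable f"
  shows "f \<in> borel_measurable borel" "\<exists>B. \<forall>x\<in>{0..1}. \<bar>f x\<bar> \<le> B"
  using assms by (auto simp: bounded_measurable_def bounded_iff)

lemma prob_space_unit_uniform: "prob_space unit_uniform"
  by (rule prob_space_uniform_measure) auto

lemma AE_unit_uniform: "AE x in unit_uniform. x \<in> {0..1}"
  by (rule AE_uniform_measureI) auto

lemma integrable_bounded_measurable:
  assumes "bounded_measurable f" shows "integrable unit_uniform f"
proof -
  interpret prob_space unit_uniform by (rule prob_space_unit_uniform)
  from bounded_measurableD[OF assms] obtain B
    where "f \<in> borel_measurable borel" "\<forall>x\<in>{0..1}. \<bar>f x\<bar> \<le> B" by blast
  then show ?thesis
    by (intro integrable_const_bound[where B = B])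
      (auto intro: eventually_mono[OF AE_unit_uniform])
qed

lemma integral_unit_uniform_mono:
  fixes f g :: "real \<Rightarrow> real"
  assumes "integrable unit_uniform f" "integrable unit_uniform g" "finite N"
    and le: "\<And>x. x \<in> {0..1} - N \<Longrightarrow> f x \<le> g x"
  shows "(\<integral>x. f x \<partial>unit_uniform) \<le> (\<integral>x. g x \<partial>unit_uniform)"
proof (rule integral_mono_AE[OF assms(1,2)])
  have "AE x in unit_uniform. x \<notin> N"
    using AE_not_in[OF finite_imp_null_set_lborel[OF \<open>finite N\<close>]]
    by (intro AE_uniform_measureI) auto
  with AE_unit_uniform show "AE x in unit_uniform. f x \<le> g x"
    by eventually_elim (rule le, auto)
qed

lemma has_integral_unit_uniform_window:
  fixes f F :: "real \<Rightarrow> real"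
  assumes [measurable]: "f \<in> borel_measurable borel" and "0 \<le> a" "a \<le> b" "b \<le> 1"
    and "\<And>x. a \<le> x \<Longrightarrow> x \<le> b \<Longrightarrow> (F has_real_derivative f x) (at x)"
    and "\<And>x. a \<le> x \<Longrightarrow> x \<le> b \<Longrightarrow> isCont f x"
  shows "has_bochner_integral unit_uniform (\<lambda>x. f x * indicator {a..b} x) (F b - F a)"
proof -
  have "unit_uniform = density lborel (\<lambda>x. ennreal (indicator {0..1} x))"
    unfolding uniform_measure_def by (intro density_cong) (auto split: split_indicator)
  moreover have "(\<lambda>x. indicator {0..1} x *\<^sub>R (f x * indicator {a..b} x))
      = (\<lambda>x. f x * indicator {a..b} x)"
    using assms by (auto split: split_indicator)
  moreover have "has_bochner_integral lborel (\<lambda>x. f x * indicator {a..b} x) (F b - F a)"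
    using assms by (intro has_bochner_integral_FTC_Icc_real) auto
  ultimately show ?thesis
    by (auto intro!: has_bochner_integral_density simp del: real_scaleR_def)
qed

section \<open>Decision rules and the dynamic programming operator\<close>

text \<open>A rule \<open>A\<close> accepts an item \<open>x\<close> in state \<open>z\<close> if \<open>A z x\<close>, and \<open>V\<close> is the value of the
  remaining problem as a function of the state.\<close>

definition decision_value :: "(real \<Rightarrow> real \<Rightarrow> bool) \<Rightarrow> (real \<Rightarrow> real) \<Rightarrow> real \<Rightarrow> real \<Rightarrow> real" where
  "decision_value A V z x = (if A z x then V x + 1 else V z)"

definition greedy_rule :: "(real \<Rightarrow> real) \<Rightarrow> real \<Rightarrow> real \<Rightarrow> bool" where
  "greedy_rule V z x \<longleftrightarrow> z \<le> x \<and> V z \<le> V x + 1"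

definition bellman :: "(real \<Rightarrow> real \<Rightarrow> bool) \<Rightarrow> (real \<Rightarrow> real) \<Rightarrow> real \<Rightarrow> real" where
  "bellman A V z = (\<integral>x. decision_value A V z x \<partial>unit_uniform)"

definition measurable_rule :: "(real \<Rightarrow> real \<Rightarrow> bool) \<Rightarrow> bool" where
  "measurable_rule A \<longleftrightarrow> Measurable.pred (borel \<Otimes>\<^sub>M borel) (\<lambda>(z, x). A z x)"

definition supersolution :: "(nat \<Rightarrow> real \<Rightarrow> real) \<Rightarrow> bool" where
  "supersolution V \<longleftrightarrow> (\<forall>k. bounded_measurable (V k)) \<and> (\<forall>z\<in>{0..1}. 0 \<le> V 0 z) \<and>
     (\<forall>k. \<forall>z\<in>{0..1}. bellman (greedy_rule (V k)) (V k) z \<le> V (Suc k) z)"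

definition subsolution :: "(nat \<Rightarrow> real \<Rightarrow> real \<Rightarrow> bool) \<Rightarrow> (nat \<Rightarrow> real \<Rightarrow> real) \<Rightarrow> bool" where
  "subsolution A V \<longleftrightarrow> (\<forall>k. bounded_measurable (V k)) \<and> (\<forall>z\<in>{0..1}. V 0 z \<le> 0) \<and>
     (\<forall>k. \<forall>z\<in>{0..1}. V (Suc k) z \<le> bellman (A (Suc k)) (V k) z)"

lemma measurable_rule_greedy:
  assumes "bounded_measurable V" shows "measurable_rule (greedy_rule V)"
proof -
  note [measurable] = bounded_measurableD(1)[OF assms]
  show ?thesis unfolding measurable_rule_def greedy_rule_def by measurable
qed

lemma measurable_rule_accepts: "measurable_rule (accepts k)"
  unfolding measurable_rule_def accepts_def by measurable

lemma decision_value_measurable: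
  assumes "measurable_rule A" "V \<in> borel_measurable borel"
  shows "(\<lambda>(z, x). decision_value A V z x) \<in> borel_measurable (borel \<Otimes>\<^sub>M borel)"
proof -
  note [measurable] = assms[unfolded measurable_rule_def]
  show ?thesis unfolding decision_value_def case_prod_beta by measurable
qed

lemma decision_value_bounded:
  assumes "bounded_measurable V"
  shows "\<exists>B. \<forall>z\<in>{0..1}. \<forall>x\<in>{0..1}. \<bar>decision_value A V z x\<bar> \<le> B"
proof -
  obtain B where "\<forall>x\<in>{0..1}. \<bar>V x\<bar> \<le> B" using bounded_measurableD(2)[OF assms] by blast
  then have "\<forall>z\<in>{0..1}. \<forall>x\<in>{0..1}. \<bar>decision_value A V z x\<bar> \<le> B + 1"
    by (force simp: decision_value_def)
  then show ?thesis by blast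
qed

lemma integrable_decision_value:
  assumes "measurable_rule A" "bounded_measurable V" "z \<in> {0..1}"
  shows "integrable unit_uniform (decision_value A V z)"
proof (rule integrable_bounded_measurable)
  note [measurable] = decision_value_measurable[OF assms(1) bounded_measurableD(1)[OF assms(2)]]
  have "(\<lambda>x. (\<lambda>(z, x). decision_value A V z x) (z, x)) \<in> borel_measurable borel" by measurable
  then have "decision_value A V z \<in> borel_measurable borel" by simp
  moreover obtain B where "\<forall>z\<in>{0..1}. \<forall>x\<in>{0..1}. \<bar>decision_value A V z x\<bar> \<le> B"
    using decision_value_bounded[OF assms(2)] by blast
  ultimately show "bounded_measurable (decision_value A V z)"
    using assms(3) by (intro bounded_measurableI[where B = B]) auto
qed

lemma decision_value_le_greedy:
  assumes "A z x \<Longrightarrow> z \<le> x"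
  shows "decision_value A V z x \<le> decision_value (greedy_rule V) V z x"
  using assms by (auto simp: decision_value_def greedy_rule_def)

lemma decision_value_mono:
  assumes "V z \<le> W z" "V x \<le> W x"
  shows "decision_value A V z x \<le> decision_value A W z x"
  using assms by (simp add: decision_value_def)

lemma bellman_mono:
  assumes "measurable_rule A" "bounded_measurable V" "bounded_measurable W"
    and "\<And>x. x \<in> {0..1} \<Longrightarrow> V x \<le> W x" "z \<in> {0..1}"
  shows "bellman A V z \<le> bellman A W z"
  unfolding bellman_def using assms
  by (intro integral_unit_uniform_mono[where N = "{}"] integrable_decision_value
      decision_value_mono) auto

lemma bellman_greedy_mono:
  assumes "bounded_measurable V" "bounded_measurable W"
    and "\<And>x. x \<in> {0..1} \<Longrightarrow> V x \<le> W x" "z \<in> {0..1}"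
  shows "bellman (greedy_rule V) V z \<le> bellman (greedy_rule W) W z"
proof -
  have "bellman (greedy_rule V) V z \<le> bellman (greedy_rule V) W z"
    using assms by (intro bellman_mono measurable_rule_greedy)
  also have "\<dots> \<le> bellman (greedy_rule W) W z"
    unfolding bellman_def using assms
    by (intro integral_unit_uniform_mono[where N = "{}"] integrable_decision_value
        measurable_rule_greedy decision_value_le_greedy) (auto simp: greedy_rule_def)
  finally show ?thesis .
qed

lemma bounded_measurable_add_const:
  assumes "bounded_measurable V" shows "bounded_measurable (\<lambda>x. V x + c)"
  using assms bounded_translation[of "V ` {0..1}" c]
  by (auto simp: bounded_measurable_def image_image add.commute)

lemma bellman_add_const:
  assumes "measurable_rule A" "bounded_measurable V" "z \<in> {0..1}"
  shows "bellman A (\<lambda>x. V x + c) z = bellman A V z + c"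
proof -
  interpret prob_space unit_uniform by (rule prob_space_unit_uniform)
  have "decision_value A (\<lambda>x. V x + c) z = (\<lambda>x. decision_value A V z x + c)"
    by (auto simp: decision_value_def)
  then show ?thesis
    using integrable_decision_value[OF assms] by (simp add: bellman_def prob_space)
qed

lemma bellman_greedy_add_const:
  assumes "bounded_measurable V" "z \<in> {0..1}"
  shows "bellman (greedy_rule (\<lambda>x. V x + c)) (\<lambda>x. V x + c) z = bellman (greedy_rule V) V z + c"
proof -
  have "greedy_rule (\<lambda>x. V x + c) = greedy_rule V" by (simp add: greedy_rule_def fun_eq_iff)
  then show ?thesis using assms by (simp add: bellman_add_const measurable_rule_greedy)
qed

lemma bellman_nonneg:
  assumes "\<And>x. 0 \<le> V x" shows "0 \<le> bellman A V z"
  unfolding bellman_def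
  by (intro Bochner_Integration.integral_nonneg) (simp add: decision_value_def assms)

lemma bellman_greedy_le_expected_count:
  assumes V: "bounded_measurable V" and le: "\<And>x. x \<in> {0..1} \<Longrightarrow> V x \<le> real k * (1 - x)"
    and z: "z \<in> {0..1}"
  shows "bellman (greedy_rule V) V z \<le> real (Suc k) * (1 - z)"
proof -
  interpret prob_space unit_uniform by (rule prob_space_unit_uniform)
  have count: "has_bochner_integral unit_uniform (\<lambda>x. 1 * indicat_real {z..1} x) (1 - z)"
    using z by (intro has_integral_unit_uniform_window) auto
  have "bellman (greedy_rule V) V z
      \<le> (\<integral>x. real k * (1 - z) + 1 * indicat_real {z..1} x \<partial>unit_uniform)"
    unfolding bellman_def
  proof (rule integral_unit_uniform_mono[where N = "{}"])
    fix x :: real assume x: "x \<in> {0..1} - {}"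
    have "V x + 1 \<le> real k * (1 - z) + 1" if "z \<le> x"
    proof -
      have "real k * (1 - x) \<le> real k * (1 - z)" using that by (intro mult_left_mono) auto
      then show ?thesis using le[of x] x by auto
    qed
    then show "decision_value (greedy_rule V) V z x
        \<le> real k * (1 - z) + 1 * indicat_real {z..1} x"
      using le[OF z] x
      by (auto simp: decision_value_def greedy_rule_def intro: add_increasing2)
  qed (use count integrable_decision_value measurable_rule_greedy V z
      in \<open>auto simp: has_bochner_integral_iff\<close>)
  also have "\<dots> = real (Suc k) * (1 - z)"
    using count prob_space by (simp add: has_bochner_integral_iff algebra_simps)
  finally show ?thesis .
qed

section \<open>The natural scale and the asymptotic profiles\<close>

definition state_scale :: "nat \<Rightarrow> real \<Rightarrow> real" where
  "state_scale k z = sqrt (2 * real k * (1 - z))"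

lemma state_scale_power2:
  assumes "z \<le> 1" shows "(state_scale k z)^2 = 2 * real k * (1 - z)"
  using assms by (simp add: state_scale_def)

lemma state_scale_nonneg: "z \<le> 1 \<Longrightarrow> 0 \<le> state_scale k z"
  by (simp add: state_scale_def)

lemma state_scale_antimono: "z \<le> x \<Longrightarrow> state_scale k x \<le> state_scale k z"
  by (simp add: state_scale_def mult_left_mono)

lemma state_scale_eq_shift:
  assumes "z \<le> 1"
  shows "state_scale k x = sqrt ((state_scale k z)^2 - 2 * (k * (x - z)))"
  unfolding state_scale_power2[OF assms] by (simp add: state_scale_def algebra_simps)

lemma state_scale_Suc_power2:
  assumes "z \<le> 1" shows "(state_scale (Suc k) z)^2 = (state_scale k z)^2 + 2 * (1 - z)"
  using assms by (simp add: state_scale_power2 algebra_simps)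

lemma state_scale_le_Suc: "z \<le> 1 \<Longrightarrow> state_scale k z \<le> state_scale (Suc k) z"
  by (simp add: state_scale_def mult_right_mono)

lemma state_scale_Suc_diff_bounds:
  assumes "z \<le> 1" "0 < state_scale k z"
  shows "(1 - z) / state_scale (Suc k) z \<le> state_scale (Suc k) z - state_scale k z"
    and "state_scale (Suc k) z - state_scale k z \<le> (1 - z) / state_scale k z"
proof -
  define p P where "p = state_scale k z" and "P = state_scale (Suc k) z"
  have p: "0 < p" "p \<le> P" using assms state_scale_le_Suc by (auto simp: p_def P_def)
  have diff: "(P - p) * (P + p) = 2 * (1 - z)"
    using state_scale_Suc_power2[OF assms(1), of k]
    by (simp add: p_def P_def algebra_simps power2_eq_square)
  have "(P - p) * (P + p) \<le> (P - p) * (2 * P)" "(P - p) * (2 * p) \<le> (P - p) * (P + p)"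
    using p by (intro mult_left_mono; simp)+
  then show "(1 - z) / P \<le> P - p" "P - p \<le> (1 - z) / p"
    using p diff by (simp_all add: field_simps)
qed

lemma state_scale_Suc_le_add:
  assumes "0 \<le> z" "z \<le> 1" shows "state_scale (Suc k) z \<le> state_scale k z + 2"
proof (rule power2_le_imp_le)
  show "(state_scale (Suc k) z)^2 \<le> (state_scale k z + 2)^2"
    using assms state_scale_nonneg[of z k]
    by (simp add: state_scale_Suc_power2 power2_sum)
qed (use assms in \<open>simp add: state_scale_nonneg\<close>)

lemma state_scale_Suc_le:
  assumes "0 \<le> z" "z \<le> 1" "0 < state_scale k z"
  shows "state_scale (Suc k) z \<le> state_scale k z + 1 / state_scale k z"
proof -
  have "(1 - z) / state_scale k z \<le> 1 / state_scale k z"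
    using assms by (intro divide_right_mono) auto
  then show ?thesis using state_scale_Suc_diff_bounds(2)[OF assms(2,3)] by linarith
qed

definition profile :: "real \<Rightarrow> real \<Rightarrow> real" where
  "profile c p = p - ln p / 6 + c / p"

definition profile_slope :: "real \<Rightarrow> real \<Rightarrow> real" where
  "profile_slope c p = 1 - 1 / (6 * p) - c / p^2"

lemma has_real_derivative_profile:
  assumes "0 < p" shows "(profile c has_real_derivative profile_slope c p) (at p)"
  unfolding profile_def[abs_def] profile_slope_def using assms
  by (auto intro!: derivative_eq_intros simp: power2_eq_square)

lemma profile_slope_mono:
  assumes "0 < q" "- 12 * c \<le> q" "q \<le> p"
  shows "profile_slope c q \<le> profile_slope c p"
proof -
  have "1 / p \<le> 1 / q" using assms by (simp add: frac_le)
  have "- 1 / 6 \<le> c * (1 / q + 1 / p)"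
  proof (cases "0 \<le> c")
    case False
    then have "c * (2 * (1 / q)) \<le> c * (1 / q + 1 / p)"
      using \<open>1 / p \<le> 1 / q\<close> by (intro mult_left_mono_neg) auto
    moreover have "- 1 / 6 \<le> c * (2 * (1 / q))" using assms by (simp add: field_simps)
    ultimately show ?thesis by linarith
  qed (use assms in \<open>auto intro: order_trans[of _ 0]\<close>)
  then have "0 \<le> (1 / q - 1 / p) * (1 / 6 + c * (1 / q + 1 / p))"
    using \<open>1 / p \<le> 1 / q\<close> by (intro mult_nonneg_nonneg) auto
  then show ?thesis
    by (simp add: profile_slope_def power2_eq_square algebra_simps)
qed

lemma profile_diff_bounds:
  assumes "0 < q" "- 12 * c \<le> q" "q \<le> p"
  shows "(p - q) * profile_slope c q \<le> profile c p - profile c q"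
    and "profile c p - profile c q \<le> (p - q) * profile_slope c p"
proof -
  have "(p - q) * profile_slope c q \<le> profile c p - profile c q
      \<and> profile c p - profile c q \<le> (p - q) * profile_slope c p"
  proof (cases "q = p")
    case False
    then obtain r where r: "q < r" "r < p"
      "profile c p - profile c q = (p - q) * profile_slope c r"
      using MVT2[of q p "profile c" "profile_slope c"] has_real_derivative_profile assms by force
    then have "profile_slope c q \<le> profile_slope c r" "profile_slope c r \<le> profile_slope c p"
      using assms by (auto intro!: profile_slope_mono)
    with r assms(3) show ?thesis by (auto intro!: mult_left_mono)
  qed simp
  then show "(p - q) * profile_slope c q \<le> profile c p - profile c q"
    "profile c p - profile c q \<le> (p - q) * profile_slope c p" by auto
qed

lemma profile_slope_ge_half:
  assumes "c \<le> 1" "2 \<le> p" shows "1 / 2 \<le> profile_slope c p"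
proof -
  have "4 \<le> p^2" using power_mono[of 2 p 2] assms by simp
  then have "c / p^2 \<le> 1 / 4" using assms by (simp add: field_simps)
  moreover have "1 / (6 * p) \<le> 1 / 12" using assms by (simp add: field_simps)
  ultimately show ?thesis unfolding profile_slope_def by linarith
qed

lemma profile_mono:
  assumes "c \<le> 1" "2 \<le> q" "q \<le> p" shows "profile c q \<le> profile c p"
proof (rule DERIV_nonneg_imp_nondecreasing[OF assms(3)])
  fix r assume "q \<le> r" "r \<le> p"
  then have "(profile c has_real_derivative profile_slope c r) (at r)" "0 \<le> profile_slope c r"
    using assms profile_slope_ge_half[of c r] by (auto intro: has_real_derivative_profile)
  then show "\<exists>d. (profile c has_real_derivative d) (at r) \<and> 0 \<le> d" by blast
qed

text \<open>The scale is cut off at 2, away from the singularity of the profile at 0.\<close>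

definition profile_value :: "real \<Rightarrow> nat \<Rightarrow> real \<Rightarrow> real" where
  "profile_value c k z = profile c (max (state_scale k z) 2)"

lemma profile_value_bounds:
  assumes "c \<le> 1" "z \<in> {0..1}"
  shows "profile c 2 \<le> profile_value c k z" "profile_value c k z \<le> profile_value c k 0"
  unfolding profile_value_def using assms
  by (auto intro!: profile_mono max.mono state_scale_antimono)

lemma profile_value_measurable: "profile_value c k \<in> borel_measurable borel"
  unfolding profile_value_def[abs_def] profile_def state_scale_def by measurable

lemma bounded_measurable_profile_value:
  assumes "c \<le> 1" shows "bounded_measurable (profile_value c k)"
  using profile_value_bounds[OF assms, of _ k]
  by (intro bounded_measurableI[OF profile_value_measurable,
        where B = "\<bar>profile c 2\<bar> + \<bar>profile_value c k 0\<bar>"]) (smt (verit))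

lemma profile_value_Suc_diff_bounds:
  fixes c z :: real and k :: nat
  defines "p \<equiv> state_scale k z"
  assumes z: "z \<in> {0..1}" and c: "c \<le> 1" and p: "2 \<le> p" "- 12 * c \<le> p"
  shows "(1 - z) / (p + 1 / p) * profile_slope c p
      \<le> profile_value c (Suc k) z - profile_value c k z"
    and "profile_value c (Suc k) z - profile_value c k z
      \<le> (1 - z) / p * profile_slope c (p + 1 / p)"
proof -
  define P where "P = state_scale (Suc k) z"
  have P: "p \<le> P" "P \<le> p + 1 / p" and diff: "(1 - z) / P \<le> P - p" "P - p \<le> (1 - z) / p"
    using state_scale_le_Suc[of z k] state_scale_Suc_le[of z k]
      state_scale_Suc_diff_bounds[of z k] z p by (auto simp: P_def p_def)
  have eq: "profile_value c (Suc k) z - profile_value c k z = profile c P - profile c p"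
    using P p by (simp add: profile_value_def P_def p_def)
  have "(1 - z) / (p + 1 / p) \<le> (1 - z) / P"
    using P p z by (intro divide_left_mono mult_pos_pos) (auto simp: add_pos_pos)
  with diff(1) have "(1 - z) / (p + 1 / p) * profile_slope c p \<le> (P - p) * profile_slope c p"
    using profile_slope_ge_half[OF c p(1)] by (intro mult_right_mono) auto
  also have "\<dots> \<le> profile c P - profile c p" using P p by (intro profile_diff_bounds) auto
  finally show "(1 - z) / (p + 1 / p) * profile_slope c p
      \<le> profile_value c (Suc k) z - profile_value c k z" by (simp add: eq)
  have "profile c P - profile c p \<le> (P - p) * profile_slope c P"
    using P p by (intro profile_diff_bounds) auto
  also have "\<dots> \<le> (1 - z) / p * profile_slope c (p + 1 / p)"
    using P p c z diff(2) profile_slope_ge_half[of c P]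
    by (intro mult_mono profile_slope_mono) auto
  finally show "profile_value c (Suc k) z - profile_value c k z
      \<le> (1 - z) / p * profile_slope c (p + 1 / p)" by (simp add: eq)
qed

section \<open>The gain over an acceptance window\<close>

text \<open>The integral of \<open>1 - a (p - sqrt (p^2 - 2 u))\<close> over \<open>0 \<le> u \<le> w\<close>; if \<open>p\<close> is the scale at
  \<open>z\<close>, then \<open>sqrt (p^2 - 2 u)\<close> is the scale at \<open>z + u / k\<close>.\<close>

definition window_gain :: "real \<Rightarrow> real \<Rightarrow> real \<Rightarrow> real" where
  "window_gain a p w = w * (1 - a * p) + a / 3 * (p^3 - sqrt (p^2 - 2 * w) ^ 3)"

lemma window_gain_0: "0 \<le> p \<Longrightarrow> window_gain a p 0 = 0"
  by (simp add: window_gain_def)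

lemma has_real_derivative_window_gain:
  assumes "2 * w < p^2"
  shows "(window_gain a p has_real_derivative 1 - a * (p - sqrt (p^2 - 2 * w))) (at w)"
proof -
  define q where "q w = sqrt (p^2 - 2 * w)" for w
  have "0 < q w" using assms by (simp add: q_def)
  have "(q has_real_derivative - 1 / q w) (at w)"
    unfolding q_def[abs_def] using assms
    by (auto intro!: derivative_eq_intros simp: field_simps)
  then have "((\<lambda>w. w * (1 - a * p) + a / 3 * (p^3 - q w ^ 3)) has_real_derivative
      (1 - a * p) + a / 3 * (- (3 * q w ^ 2 * (- 1 / q w)))) (at w)"
    by (auto intro!: derivative_eq_intros)
  moreover have "(1 - a * p) + a / 3 * (- (3 * q w ^ 2 * (- 1 / q w))) = 1 - a * (p - q w)"
    using \<open>0 < q w\<close> by (simp add: field_simps power2_eq_square)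
  ultimately show ?thesis
    unfolding window_gain_def[abs_def] q_def[symmetric] by (simp only:)
qed

lemma has_integral_window_gain:
  fixes z :: real and k :: nat
  defines "p \<equiv> state_scale k z"
  assumes z: "z \<in> {0..1}" and w: "0 \<le> w" "2 * w < p^2"
  shows "has_bochner_integral unit_uniform
    (\<lambda>x. (1 - a * (p - state_scale k x)) * indicator {z..z + w / k} x) (window_gain a p w / k)"
proof -
  have p2: "p^2 = 2 * real k * (1 - z)" using z by (simp add: p_def state_scale_power2)
  have k: "0 < k" using w p2 by (cases k) auto
  have "z \<le> 1" using z by simp
  define F where "F x = window_gain a p (k * (x - z)) / k" for x
  have "(F has_real_derivative 1 - a * (p - state_scale k x)) (at x)" if "x \<le> z + w / k" for x
  proof -
    have "k * (x - z) \<le> w" using that k by (simp add: field_simps)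
    then have "((\<lambda>x. window_gain a p (k * (x - z))) has_real_derivative
        (1 - a * (p - state_scale k x)) * k) (at x)"
      unfolding state_scale_eq_shift[OF \<open>z \<le> 1\<close>, of k x] p_def[symmetric]
      using w by (intro DERIV_chain2[OF has_real_derivative_window_gain])
        (auto intro!: derivative_eq_intros)
    then show ?thesis
      unfolding F_def[abs_def] using k by (auto intro!: derivative_eq_intros)
  qed
  moreover have "z + w / k \<le> 1" using w k p2 by (simp add: field_simps)
  moreover have "isCont (\<lambda>x. 1 - a * (p - state_scale k x)) x" for x
    unfolding state_scale_def by (intro continuous_intros)
  ultimately have "has_bochner_integral unit_uniform
    (\<lambda>x. (1 - a * (p - state_scale k x)) * indicator {z..z + w / k} x) (F (z + w / k) - F z)"
    using z w k by (intro has_integral_unit_uniform_window) (auto simp: state_scale_def)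
  moreover have "0 \<le> p" using z by (simp add: p_def state_scale_nonneg)
  then have "F (z + w / k) - F z = window_gain a p w / k"
    using k by (simp add: F_def window_gain_0)
  ultimately show ?thesis by simp
qed

lemma has_integral_add_window_gain:
  fixes z :: real and k :: nat
  defines "p \<equiv> state_scale k z"
  assumes "z \<in> {0..1}" "0 \<le> w" "2 * w < p^2"
  shows "has_bochner_integral unit_uniform
    (\<lambda>x. v + (1 - a * (p - state_scale k x)) * indicator {z..z + w / k} x)
    (v + window_gain a p w / k)"
proof -
  interpret prob_space unit_uniform by (rule prob_space_unit_uniform)
  have "has_bochner_integral unit_uniform (\<lambda>_. v) v"
    by (simp add: has_bochner_integral_iff prob_space)
  then show ?thesis
    using assms by (auto intro!: has_bochner_integral_add has_integral_window_gain)
qed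

text \<open>The integrand \<open>1 - a (p - q)\<close> of the gain vanishes at \<open>q = p - 1 / a\<close>.\<close>

definition optimal_window :: "real \<Rightarrow> real \<Rightarrow> real" where
  "optimal_window a p = p / a - 1 / (2 * a^2)"

lemma power2_minus_optimal_window:
  assumes "a \<noteq> 0" shows "p^2 - 2 * optimal_window a p = (p - 1 / a)^2"
  using assms by (simp add: optimal_window_def field_simps power2_eq_square)

lemma optimal_window_nonneg:
  assumes "0 < a" "1 / a \<le> p" shows "0 \<le> optimal_window a p"
proof -
  have "1 / a / 2 \<le> 1 / a" using \<open>0 < a\<close> by (simp add: field_simps)
  with assms have "0 \<le> (1 / a) * (p - 1 / a / 2)" by (intro mult_nonneg_nonneg) auto
  then show ?thesis by (simp add: optimal_window_def power2_eq_square algebra_simps)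
qed

lemma window_gain_optimal_window:
  assumes "0 < a" "1 / a \<le> p"
  shows "window_gain a p (optimal_window a p) = p / (2 * a) - 1 / (6 * a^2)"
proof -
  have "sqrt (p^2 - 2 * optimal_window a p) = p - 1 / a"
    using assms by (simp add: power2_minus_optimal_window)
  then have "window_gain a p (optimal_window a p)
      = (p / a - 1 / (2 * a^2)) * (1 - a * p) + a / 3 * (p^3 - (p - 1 / a)^3)"
    by (simp only: window_gain_def optimal_window_def)
  also have "\<dots> = p / (2 * a) - 1 / (6 * a^2)"
    using assms by (simp add: field_simps power2_eq_square power3_eq_cube)
  finally show ?thesis .
qed

lemma optimal_window_iff:
  fixes z :: real and k :: nat
  defines "p \<equiv> state_scale k z"
  assumes "z \<le> 1" "x \<le> 1" "0 < k" "0 < a" "1 / a \<le> p"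
  shows "x \<le> z + optimal_window a p / k \<longleftrightarrow> 0 \<le> 1 - a * (p - state_scale k x)"
proof -
  have "0 \<le> 1 - a * (p - state_scale k x) \<longleftrightarrow> p - 1 / a \<le> state_scale k x"
    using \<open>0 < a\<close> by (simp add: field_simps)
  also have "\<dots> \<longleftrightarrow> (p - 1 / a)^2 \<le> (state_scale k x)^2"
    using assms state_scale_nonneg[of x k]
      abs_le_square_iff[of "p - 1 / a" "state_scale k x"] by simp
  also have "(p - 1 / a)^2 = 2 * real k * (1 - z) - 2 * optimal_window a p"
    using assms by (simp add: power2_minus_optimal_window[symmetric] state_scale_power2)
  also have "\<dots> \<le> (state_scale k x)^2 \<longleftrightarrow> k * (x - z) \<le> optimal_window a p"
    using \<open>x \<le> 1\<close> by (auto simp: state_scale_power2 algebra_simps)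
  also have "\<dots> \<longleftrightarrow> x \<le> z + optimal_window a p / k" using \<open>0 < k\<close> by (simp add: field_simps)
  finally show ?thesis by simp
qed

lemma window_gain_scale_ge:
  assumes "0 \<le> a" "2 < p" "0 \<le> t" "t \<le> 1"
  shows "t * window_gain a p p \<le> window_gain a p (t * p)"
proof -
  have "2 * p < p^2" using assms by (simp add: power2_eq_square)
  then have "((\<lambda>w. - window_gain a p w) has_real_derivative
      a * (p - sqrt (p^2 - 2 * w)) - 1) (at w)" if "w \<le> p" for w
    using DERIV_minus[OF has_real_derivative_window_gain[of w p a]] that by simp
  then have "convex_on {..p} (\<lambda>w. - window_gain a p w)"
    using assms
    by (intro convex_on_realI[where f' = "\<lambda>w. a * (p - sqrt (p^2 - 2 * w)) - 1"])
      (auto intro!: mult_left_mono)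
  from convex_onD[OF this assms(3,4), of 0 p] assms show ?thesis
    by (simp add: window_gain_0)
qed

section \<open>A supersolution for the optimal value\<close>

lemma eventually_optimal_gain_le:
  "\<forall>\<^sub>F p in at_top.
     p / (2 * profile_slope (-1) (p - 2)) - 1 / (6 * (profile_slope (-1) (p - 2))^2)
     \<le> p^2 / 2 / (p + 1 / p) * profile_slope (-1) p"
  unfolding profile_slope_def by real_asymp

text \<open>By convexity of the profile, its slope at \<open>p - 2\<close> may be used on \<open>[p - 2, p]\<close>. As this slope
  is at least \<open>1 / 2\<close>, the resulting linear minorant of the loss reaches 1 within that interval.\<close>

lemma profile_value_drop_ge:
  fixes c z :: real and k :: nat
  defines "p \<equiv> state_scale k z"
  defines "a \<equiv> profile_slope c (p - 2)"
  assumes c: "c \<le> 1" and p: "4 \<le> p" "- 12 * c \<le> p - 2" and "z \<le> x"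
  shows "min 1 (a * (p - state_scale k x)) \<le> profile_value c k z - profile_value c k x"
proof -
  define q where "q = max (state_scale k x) (p - 1 / a)"
  have a: "1 / 2 \<le> a" unfolding a_def using c p by (intro profile_slope_ge_half) auto
  then have inverse_a: "0 < 1 / a" "1 / a \<le> 2" by (auto simp: field_simps)
  have q: "p - 2 \<le> q" "q \<le> p" "state_scale k x \<le> q"
    using state_scale_antimono[OF \<open>z \<le> x\<close>, of k] inverse_a by (auto simp: q_def p_def)
  have "min 1 (a * (p - state_scale k x)) = a * (p - q)"
    using a by (auto simp: q_def max_def min_def field_simps)
  also have "\<dots> \<le> profile_slope c q * (p - q)"
    unfolding a_def using q p by (intro mult_right_mono profile_slope_mono) auto
  also have "\<dots> \<le> profile c p - profile c q"
    using profile_diff_bounds(1)[of q c p] q p by (simp add: mult.commute)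
  also have "\<dots> \<le> profile_value c k z - profile_value c k x"
    using profile_mono[of c "max (state_scale k x) 2" q] c p q
    by (simp add: profile_value_def p_def)
  finally show ?thesis .
qed

lemma bellman_greedy_profile_value_le:
  fixes c z :: real and k :: nat
  defines "p \<equiv> state_scale k z"
  defines "a \<equiv> profile_slope c (p - 2)"
  assumes z: "z \<in> {0..1}" and c: "c \<le> 1" and p: "4 \<le> p" "- 12 * c \<le> p - 2"
  shows "bellman (greedy_rule (profile_value c k)) (profile_value c k) z
    \<le> profile_value c k z + (p / (2 * a) - 1 / (6 * a^2)) / k"
proof -
  let ?V = "profile_value c k" and ?w = "optimal_window a p"
  let ?f = "\<lambda>x. 1 - a * (p - state_scale k x)"
  have "1 / 2 \<le> a" unfolding a_def using c p by (intro profile_slope_ge_half) auto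
  then have "0 < a" "1 / a \<le> 2" by (auto simp: field_simps)
  with p have a: "0 < a" "1 / a < p" by linarith+
  have k: "0 < k" using p by (cases k) (auto simp: p_def state_scale_def)
  have "p^2 - 2 * ?w = (p - 1 / a)^2" using a by (intro power2_minus_optimal_window) auto
  also have "0 < \<dots>" using a by simp
  finally have "2 * ?w < p^2" by simp
  then have gain: "has_bochner_integral unit_uniform
      (\<lambda>x. ?V z + ?f x * indicator {z..z + ?w / k} x) (?V z + window_gain a p ?w / k)"
    unfolding p_def using z a p_def
    by (intro has_integral_add_window_gain optimal_window_nonneg) auto
  have "bellman (greedy_rule ?V) ?V z
      \<le> (\<integral>x. ?V z + ?f x * indicator {z..z + ?w / k} x \<partial>unit_uniform)"
    unfolding bellman_def
  proof (rule integral_unit_uniform_mono[where N = "{}"])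
    fix x :: real assume x: "x \<in> {0..1} - {}"
    show "decision_value (greedy_rule ?V) ?V z x \<le> ?V z + ?f x * indicator {z..z + ?w / k} x"
    proof (cases "z \<le> x")
      case True
      have "?V x + 1 \<le> ?V z + max 0 (?f x)"
        using profile_value_drop_ge[OF c p[unfolded p_def] True, folded p_def, folded a_def]
        by linarith
      moreover have "max 0 (?f x) = ?f x * indicator {z..z + ?w / k} x"
        using optimal_window_iff[of z x k a, folded p_def] x z k a True
        by (auto simp: max_def split: split_indicator)
      ultimately show ?thesis by (auto simp: decision_value_def)
    qed (simp add: decision_value_def greedy_rule_def)
  qed (use gain z c in \<open>auto simp: has_bochner_integral_iff intro!: integrable_decision_value
      measurable_rule_greedy bounded_measurable_profile_value\<close>)
  also have "\<dots> = ?V z + window_gain a p ?w / k"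
    using gain by (rule has_bochner_integral_integral_eq)
  also have "window_gain a p ?w = p / (2 * a) - 1 / (6 * a^2)"
    using a by (intro window_gain_optimal_window) auto
  finally show ?thesis .
qed

lemma bellman_greedy_profile_value_le_Suc:
  fixes z :: real and k :: nat
  defines "p \<equiv> state_scale k z"
  defines "a \<equiv> profile_slope (-1) (p - 2)"
  assumes z: "z \<in> {0..1}" and p: "14 \<le> p"
    and gain: "p / (2 * a) - 1 / (6 * a^2) \<le> p^2 / 2 / (p + 1 / p) * profile_slope (-1) p"
  shows "bellman (greedy_rule (profile_value (-1) k)) (profile_value (-1) k) z
    \<le> profile_value (-1) (Suc k) z"
proof -
  have k: "0 < k" using p by (cases k) (auto simp: p_def state_scale_def)
  have "p^2 / 2 / k = 1 - z" using z k by (simp add: p_def state_scale_power2)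
  then have scale: "p^2 / 2 / (p + 1 / p) * profile_slope (-1) p / k
      = (1 - z) / (p + 1 / p) * profile_slope (-1) p"
    by (metis divide_divide_eq_left mult.commute times_divide_eq_left)
  have "bellman (greedy_rule (profile_value (-1) k)) (profile_value (-1) k) z
      \<le> profile_value (-1) k z + (p / (2 * a) - 1 / (6 * a^2)) / k"
    unfolding p_def a_def using z p p_def by (intro bellman_greedy_profile_value_le) auto
  also have "(p / (2 * a) - 1 / (6 * a^2)) / k \<le> (1 - z) / (p + 1 / p) * profile_slope (-1) p"
    unfolding scale[symmetric] using gain by (intro divide_right_mono) auto
  also have "\<dots> \<le> profile_value (-1) (Suc k) z - profile_value (-1) k z"
    unfolding p_def using z p p_def by (intro profile_value_Suc_diff_bounds(1)) auto
  finally show ?thesis by simp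
qed

text \<open>The minimum with the expected number of items above \<open>z\<close> makes \<open>upper_value\<close> a supersolution
  also where the asymptotic inequality fails.\<close>

definition upper_value :: "real \<Rightarrow> nat \<Rightarrow> real \<Rightarrow> real" where
  "upper_value C k z = min (real k * (1 - z)) (profile_value (-1) k z + C)"

lemma bounded_measurable_upper_value: "bounded_measurable (upper_value C k)"
proof -
  obtain B where "\<forall>z\<in>{0..1}. \<bar>profile_value (-1) k z\<bar> \<le> B"
    using bounded_measurableD(2)[OF bounded_measurable_profile_value[of "-1" k]] by auto
  moreover have "0 \<le> real k * (1 - z)" "real k * (1 - z) \<le> k" if "z \<in> {0..1}" for z
    using that by (auto intro: mult_left_le)
  ultimately have "\<bar>upper_value C k z\<bar> \<le> B + \<bar>C\<bar> + real k" if "z \<in> {0..1}" for z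
    unfolding upper_value_def using that by (smt (verit, best))
  moreover have "upper_value C k \<in> borel_measurable borel"
    unfolding upper_value_def[abs_def] using profile_value_measurable by measurable
  ultimately show ?thesis by (intro bounded_measurableI)
qed

lemma bellman_greedy_upper_value_le:
  assumes "z \<in> {0..1}"
  shows "bellman (greedy_rule (upper_value C k)) (upper_value C k) z \<le> real (Suc k) * (1 - z)"
    and "bellman (greedy_rule (upper_value C k)) (upper_value C k) z
      \<le> bellman (greedy_rule (profile_value (-1) k)) (profile_value (-1) k) z + C"
proof -
  let ?V = "upper_value C k" and ?W = "\<lambda>x. profile_value (-1) k x + C"
  show "bellman (greedy_rule ?V) ?V z \<le> real (Suc k) * (1 - z)"
    using assms by (intro bellman_greedy_le_expected_count bounded_measurable_upper_value)
      (auto simp: upper_value_def)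
  have "bellman (greedy_rule ?V) ?V z \<le> bellman (greedy_rule ?W) ?W z"
    using assms by (intro bellman_greedy_mono bounded_measurable_upper_value
        bounded_measurable_add_const bounded_measurable_profile_value)
      (auto simp: upper_value_def)
  also have "\<dots> = bellman (greedy_rule (profile_value (-1) k)) (profile_value (-1) k) z + C"
    using assms by (intro bellman_greedy_add_const bounded_measurable_profile_value) auto
  finally show "bellman (greedy_rule ?V) ?V z
      \<le> bellman (greedy_rule (profile_value (-1) k)) (profile_value (-1) k) z + C" .
qed

lemma ex_supersolution: "\<exists>C. supersolution (upper_value C)"
proof -
  let ?a = "\<lambda>p. profile_slope (-1) (p - 2)"
  have "\<forall>\<^sub>F p in at_top. 14 \<le> p \<and>
      p / (2 * ?a p) - 1 / (6 * (?a p)^2) \<le> p^2 / 2 / (p + 1 / p) * profile_slope (-1) p"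
    using eventually_optimal_gain_le eventually_ge_at_top by (rule eventually_conj[rotated])
  then obtain p0 where p0: "\<And>p. p0 \<le> p \<Longrightarrow> 14 \<le> p"
    "\<And>p. p0 \<le> p \<Longrightarrow>
      p / (2 * ?a p) - 1 / (6 * (?a p)^2) \<le> p^2 / 2 / (p + 1 / p) * profile_slope (-1) p"
    unfolding eventually_at_top_linorder by blast
  define C where "C = p0^2 / 2 + 1 - profile (-1) 2"
  let ?V = "upper_value C"
  have large: "p0^2 / 2 + 1 \<le> profile_value (-1) k z + C" if "z \<in> {0..1}" for k z
    using profile_value_bounds(1)[of "-1" z k] that by (simp add: C_def)
  have "bellman (greedy_rule (?V k)) (?V k) z \<le> ?V (Suc k) z" if z: "z \<in> {0..1}" for k z
  proof -
    note upper = bellman_greedy_upper_value_le[OF z, where C = C and k = k]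
    moreover have "bellman (greedy_rule (?V k)) (?V k) z \<le> profile_value (-1) (Suc k) z + C"
    proof (cases "p0 \<le> state_scale k z")
      case True
      with upper(2) bellman_greedy_profile_value_le_Suc[OF z p0] show ?thesis by fastforce
    next
      case False
      then have "(state_scale k z)^2 \<le> p0^2" using z by (intro power_mono state_scale_nonneg) auto
      then have "real (Suc k) * (1 - z) \<le> p0^2 / 2 + 1"
        using z by (simp add: state_scale_power2 algebra_simps)
      with upper(1) large[OF z, of "Suc k"] show ?thesis by linarith
    qed
    ultimately show ?thesis by (simp add: upper_value_def)
  qed
  moreover have "0 \<le> ?V 0 z" if "z \<in> {0..1}" for z
    using order_trans[OF _ large[OF that]] by (simp add: upper_value_def)
  ultimately show ?thesis
    unfolding supersolution_def using bounded_measurable_upper_value by blast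
qed

section \<open>A subsolution for the value of the heuristic policy\<close>

lemma eventually_heuristic_gain_ge:
  "\<forall>\<^sub>F p in at_top. p / 2 * profile_slope 1 (p + 1 / p)
     \<le> p / (p + 1 / p) * window_gain (profile_slope 1 p) p p"
  unfolding profile_slope_def window_gain_def by real_asymp

lemma accepts_iff:
  assumes "z < 1" "0 < k"
  shows "accepts k z x \<longleftrightarrow> z < x \<and> x \<le> z + 2 * (1 - z) / state_scale k z"
proof -
  have "sqrt (2 / (real k * (1 - z))) = sqrt (4 / (2 * real k * (1 - z)))" by simp
  also have "\<dots> = 2 / state_scale k z"
    by (simp only: real_sqrt_divide real_sqrt_four state_scale_def)
  finally have "(x - z) / (1 - z) \<le> sqrt (2 / (real k * (1 - z)))
      \<longleftrightarrow> x - z \<le> 2 / state_scale k z * (1 - z)"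
    using assms by (simp add: pos_divide_le_eq)
  then show ?thesis
    using assms by (auto simp: accepts_def algebra_simps zero_less_divide_iff)
qed

lemma profile_value_drop_le:
  fixes c z :: real and k :: nat
  defines "p \<equiv> state_scale k z"
  assumes c: "0 \<le> c" and p: "4 \<le> p" and x: "z \<le> x" "x \<le> 1" "k * (x - z) \<le> p"
  shows "profile_value c k z - profile_value c k x
    \<le> profile_slope c p * (p - state_scale k x)"
proof -
  let ?q = "state_scale k x"
  have "4 * p \<le> p^2" using p by (simp add: power2_eq_square)
  then have "2^2 \<le> p^2 - 2 * (k * (x - z))" using x(3) p by simp
  then have "2 \<le> ?q"
    using x state_scale_eq_shift[of z k x, folded p_def] by (auto intro: real_le_rsqrt)
  moreover have "?q \<le> p" unfolding p_def using x(1) by (rule state_scale_antimono)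
  ultimately show ?thesis
    using profile_diff_bounds(2)[of ?q c p] c p
    by (simp add: profile_value_def p_def mult.commute)
qed

lemma bellman_accepts_profile_value_ge:
  fixes c z :: real and k :: nat
  defines "p \<equiv> state_scale k z"
  defines "w \<equiv> p^2 / state_scale (Suc k) z"
  assumes z: "z \<in> {0..1}" and c: "0 \<le> c" "c \<le> 1" and p: "4 \<le> p"
  shows "profile_value c k z + window_gain (profile_slope c p) p w / k
    \<le> bellman (accepts (Suc k)) (profile_value c k) z"
proof -
  let ?V = "profile_value c k" and ?a = "profile_slope c p"
  let ?f = "\<lambda>x. 1 - ?a * (p - state_scale k x)"
  have k: "0 < k" using p by (cases k) (auto simp: p_def state_scale_def)
  have p2: "p^2 = 2 * real k * (1 - z)" using z by (simp add: p_def state_scale_power2)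
  have "z < 1" using p z p2 by (cases "z = 1") auto
  have P: "p \<le> state_scale (Suc k) z" using z by (simp add: p_def state_scale_le_Suc)
  have w: "0 \<le> w" "w \<le> p"
    using P p by (auto simp: w_def power2_eq_square pos_divide_le_eq intro!: mult_left_mono)
  moreover have "2 * p < p^2" using p by (simp add: power2_eq_square)
  ultimately have gain: "has_bochner_integral unit_uniform
      (\<lambda>x. ?V z + ?f x * indicator {z..z + w / k} x) (?V z + window_gain ?a p w / k)"
    unfolding p_def using z p_def by (intro has_integral_add_window_gain) auto
  have accepts: "accepts (Suc k) z x \<longleftrightarrow> z < x \<and> x \<le> z + w / k" for x
    using accepts_iff[of z "Suc k" x] \<open>z < 1\<close> k by (simp add: w_def p2)
  have "?V z + window_gain ?a p w / k
      = (\<integral>x. ?V z + ?f x * indicator {z..z + w / k} x \<partial>unit_uniform)"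
    using gain by (rule has_bochner_integral_integral_eq[symmetric])
  also have "\<dots> \<le> bellman (accepts (Suc k)) ?V z"
    unfolding bellman_def
  proof (rule integral_unit_uniform_mono[where N = "{z}"])
    fix x assume x: "x \<in> {0..1} - {z}"
    show "?V z + ?f x * indicator {z..z + w / k} x \<le> decision_value (accepts (Suc k)) ?V z x"
    proof (cases "accepts (Suc k) z x")
      case True
      then have "z \<le> x" "k * (x - z) \<le> w" using k by (auto simp: accepts field_simps)
      then have "?V z - ?V x \<le> ?a * (p - state_scale k x)"
        unfolding p_def using c p x w p_def by (intro profile_value_drop_le) auto
      then show ?thesis using True accepts[of x] by (simp add: decision_value_def)
    next
      case False
      then show ?thesis
        using accepts[of x] x by (auto simp: decision_value_def split: split_indicator)
    qed
  qed (use gain z c in \<open>auto simp: has_bochner_integral_iff intro!: integrable_decision_value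
      measurable_rule_accepts bounded_measurable_profile_value\<close>)
  finally show ?thesis .
qed

lemma bellman_accepts_profile_value_ge_Suc:
  fixes z :: real and k :: nat
  defines "p \<equiv> state_scale k z"
  assumes z: "z \<in> {0..1}" and p: "4 \<le> p"
    and gain: "p / 2 * profile_slope 1 (p + 1 / p)
      \<le> p / (p + 1 / p) * window_gain (profile_slope 1 p) p p"
  shows "profile_value 1 (Suc k) z \<le> bellman (accepts (Suc k)) (profile_value 1 k) z"
proof -
  define P t where "P = state_scale (Suc k) z" and "t = p / P"
  let ?J = "window_gain (profile_slope 1 p) p"
  have k: "0 < k" using p by (cases k) (auto simp: p_def state_scale_def)
  have P: "p \<le> P" "P \<le> p + 1 / p"
    using state_scale_le_Suc[of z k] state_scale_Suc_le[of z k] z p by (auto simp: P_def p_def)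
  have t: "0 \<le> t" "t \<le> 1" "p / (p + 1 / p) \<le> t"
    using P p by (auto simp: t_def intro!: divide_left_mono)
  have "0 < 1 / p" using p by simp
  then have "1 / 2 \<le> profile_slope 1 (p + 1 / p)"
    using p by (intro profile_slope_ge_half) linarith+
  then have "0 \<le> p / 2 * profile_slope 1 (p + 1 / p)" using p by simp
  moreover have "0 < p / (p + 1 / p)" using p \<open>0 < 1 / p\<close> by (intro divide_pos_pos) linarith+
  ultimately have "0 \<le> ?J p" using gain by (meson order_trans zero_le_mult_iff not_less)
  then have "p / (p + 1 / p) * ?J p \<le> t * ?J p" using t by (intro mult_right_mono)
  also have "\<dots> \<le> ?J (t * p)"
    using t p profile_slope_ge_half[of 1 p] by (intro window_gain_scale_ge) auto
  also have "t * p = p^2 / P" by (simp add: t_def power2_eq_square)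
  finally have "p / 2 * profile_slope 1 (p + 1 / p) \<le> ?J (p^2 / P)" using gain by linarith
  moreover have "(1 - z) / p = p / 2 / k"
    using state_scale_power2[of z k] z k p
    by (simp add: p_def[symmetric] field_simps power2_eq_square)
  moreover have "profile_value 1 (Suc k) z - profile_value 1 k z
      \<le> (1 - z) / p * profile_slope 1 (p + 1 / p)"
    unfolding p_def using z p p_def by (intro profile_value_Suc_diff_bounds(2)) auto
  ultimately have "profile_value 1 (Suc k) z \<le> profile_value 1 k z + ?J (p^2 / P) / k"
    using k divide_right_mono[of _ "?J (p^2 / P)" "real k"] by fastforce
  also have "\<dots> \<le> bellman (accepts (Suc k)) (profile_value 1 k) z"
    unfolding p_def P_def using z p p_def by (intro bellman_accepts_profile_value_ge) auto
  finally show ?thesis .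
qed

definition lower_value :: "real \<Rightarrow> nat \<Rightarrow> real \<Rightarrow> real" where
  "lower_value C k z = max 0 (profile_value 1 k z - C)"

lemma bounded_measurable_lower_value: "bounded_measurable (lower_value C k)"
proof -
  obtain B where "\<forall>z\<in>{0..1}. \<bar>profile_value 1 k z\<bar> \<le> B"
    using bounded_measurableD(2)[OF bounded_measurable_profile_value[of 1 k]] by auto
  then have "\<bar>lower_value C k z\<bar> \<le> B + \<bar>C\<bar>" if "z \<in> {0..1}" for z
    unfolding lower_value_def using that by (smt (verit, best))
  moreover have "lower_value C k \<in> borel_measurable borel"
    unfolding lower_value_def[abs_def] using profile_value_measurable by measurable
  ultimately show ?thesis by (intro bounded_measurableI)
qed

lemma bellman_lower_value_ge:
  assumes "measurable_rule A" "z \<in> {0..1}"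
  shows "0 \<le> bellman A (lower_value C k) z"
    and "bellman A (profile_value 1 k) z - C \<le> bellman A (lower_value C k) z"
proof -
  show "0 \<le> bellman A (lower_value C k) z" by (intro bellman_nonneg) (simp add: lower_value_def)
  have "bellman A (profile_value 1 k) z - C = bellman A (\<lambda>x. profile_value 1 k x + (- C)) z"
    using assms by (subst bellman_add_const) (simp_all add: bounded_measurable_profile_value)
  also have "\<dots> \<le> bellman A (lower_value C k) z"
    using assms by (intro bellman_mono bounded_measurable_lower_value bounded_measurable_add_const
        bounded_measurable_profile_value) (auto simp: lower_value_def)
  finally show "bellman A (profile_value 1 k) z - C \<le> bellman A (lower_value C k) z" .
qed

lemma ex_subsolution: "\<exists>C. subsolution accepts (lower_value C)"
proof -
  have "\<forall>\<^sub>F p in at_top. 4 \<le> p \<and> p / 2 * profile_slope 1 (p + 1 / p)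
      \<le> p / (p + 1 / p) * window_gain (profile_slope 1 p) p p"
    using eventually_heuristic_gain_ge eventually_ge_at_top by (rule eventually_conj[rotated])
  then obtain p0 where p0: "\<And>p. p0 \<le> p \<Longrightarrow> 4 \<le> p"
    "\<And>p. p0 \<le> p \<Longrightarrow> p / 2 * profile_slope 1 (p + 1 / p)
      \<le> p / (p + 1 / p) * window_gain (profile_slope 1 p) p p"
    unfolding eventually_at_top_linorder by blast
  have "4 \<le> p0" using p0(1) by simp
  define C where "C = profile 1 (p0 + 2)"
  let ?V = "lower_value C"
  have small: "?V k z = 0" if "state_scale k z \<le> p0 + 2" for k z
  proof -
    have "profile_value 1 k z \<le> C"
      unfolding profile_value_def C_def using that \<open>4 \<le> p0\<close> by (intro profile_mono) auto
    then show ?thesis by (simp add: lower_value_def)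
  qed
  have "?V (Suc k) z \<le> bellman (accepts (Suc k)) (?V k) z" if z: "z \<in> {0..1}" for k z
  proof (cases "state_scale (Suc k) z \<le> p0 + 2")
    case True
    then show ?thesis
      using small bellman_lower_value_ge(1)[OF measurable_rule_accepts z] by simp
  next
    case False
    then have "p0 \<le> state_scale k z" using state_scale_Suc_le_add[of z k] z by simp
    then have "profile_value 1 (Suc k) z \<le> bellman (accepts (Suc k)) (profile_value 1 k) z"
      by (intro bellman_accepts_profile_value_ge_Suc z p0)
    with bellman_lower_value_ge[OF measurable_rule_accepts[of "Suc k"] z, where C = C and k = k]
    show ?thesis unfolding lower_value_def[of C "Suc k"] by simp
  qed
  moreover have "?V 0 z \<le> 0" for z using small[of 0 z] \<open>4 \<le> p0\<close> by (simp add: state_scale_def)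
  ultimately show ?thesis
    unfolding subsolution_def using bounded_measurable_lower_value by blast
qed

lemma upper_minus_lower_value: "upper_value C k z - lower_value D k z \<le> C + D"
proof -
  have "profile_value (-1) k z \<le> profile_value 1 k z"
    by (auto simp: profile_value_def profile_def max_def)
  then show ?thesis by (auto simp: upper_value_def lower_value_def)
qed

section \<open>Independence and expectation\<close>

lemma Int_stable_vimage: "Int_stable {f -` A \<inter> \<Omega> | A. A \<in> sets N}"
proof (rule Int_stableI)
  fix a b assume "a \<in> {f -` A \<inter> \<Omega> | A. A \<in> sets N}" "b \<in> {f -` A \<inter> \<Omega> | A. A \<in> sets N}"
  then obtain A B where "A \<in> sets N" "B \<in> sets N" "a = f -` A \<inter> \<Omega>" "b = f -` B \<inter> \<Omega>" by blast
  then have "A \<inter> B \<in> sets N" "a \<inter> b = f -` (A \<inter> B) \<inter> \<Omega>" by auto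
  then show "a \<inter> b \<in> {f -` A \<inter> \<Omega> | A. A \<in> sets N}" by blast
qed

lemma (in prob_space) indep_var_sigma_vimage:
  assumes X: "indep_vars N X I" and J: "J \<subseteq> I" and k: "k \<in> I" "k \<notin> J"
    and Z: "Z \<in> measurable
      (sigma (space M) (\<Union>j\<in>J. {X j -` A \<inter> space M | A. A \<in> sets (N j)})) L"
  shows "indep_var L Z (N k) (X k)"
proof -
  let ?E = "\<lambda>j. {X j -` A \<inter> space M | A. A \<in> sets (N j)}"
  let ?\<sigma> = "sigma_sets (space M)"
  define F where "F = sigma (space M) (\<Union>j\<in>J. ?E j)"
  have rv: "random_variable (N j) (X j)" if "j \<in> I" for j
    using X that by (auto simp: indep_vars_def2)
  have sets_F: "sets F = ?\<sigma> (\<Union>j\<in>J. ?E j)"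
    unfolding F_def by (rule sets_measure_of) auto
  also have "\<dots> \<subseteq> events"
    using J rv by (intro sets.sigma_sets_subset) (auto intro: measurable_sets)
  finally have "subalgebra M F" by (simp add: subalgebra_def F_def space_measure_of_conv)
  have Z_F: "Z \<in> measurable F L" using Z by (simp add: F_def)
  then have "{Z -` A \<inter> space M | A. A \<in> sets L} \<subseteq> sets F"
    using \<open>subalgebra M F\<close> by (auto simp: subalgebra_def dest: measurable_sets)
  then have Z_sub: "?\<sigma> {Z -` A \<inter> space M | A. A \<in> sets L} \<subseteq> ?\<sigma> (\<Union>j\<in>J. ?E j)"
    unfolding sets_F by (rule sigma_sets_mono)
  have "(\<Union>b\<in>UNIV. case_bool J {k} b) \<subseteq> I" using J k by (auto simp: UNIV_bool)
  moreover have "indep_sets ?E I" using X by (simp add: indep_vars_def2)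
  ultimately have "indep_sets ?E (\<Union>b\<in>UNIV. case_bool J {k} b)" by (rule indep_sets_mono_index)
  moreover have "disjoint_family_on (case_bool J {k}) UNIV"
    using k by (auto simp: disjoint_family_on_def split: bool.split)
  ultimately have "indep_sets (\<lambda>b. ?\<sigma> (\<Union>j\<in>case_bool J {k} b. ?E j)) UNIV"
    using Int_stable_vimage by (intro indep_sets_collect_sigma)
  then have "indep_set (?\<sigma> {Z -` A \<inter> space M | A. A \<in> sets L}) (?\<sigma> (?E k))"
    unfolding indep_set_def
    by (rule indep_sets_mono_sets) (use Z_sub in \<open>auto split: bool.split\<close>)
  then show ?thesis
    unfolding indep_var_eq using k rv measurable_from_subalg[OF \<open>subalgebra M F\<close> Z_F] by blast
qed

lemma (in prob_space) expectation_indep_var: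
  fixes f :: "'b \<times> 'b \<Rightarrow> real"
  assumes indep: "indep_var S Z T Y" and f [measurable]: "f \<in> borel_measurable (S \<Otimes>\<^sub>M T)"
    and integrable_f: "integrable M (\<lambda>\<omega>. f (Z \<omega>, Y \<omega>))"
  shows "integrable M (\<lambda>\<omega>. \<integral>y. f (Z \<omega>, y) \<partial>distr M T Y)"
    and "expectation (\<lambda>\<omega>. f (Z \<omega>, Y \<omega>)) = expectation (\<lambda>\<omega>. \<integral>y. f (Z \<omega>, y) \<partial>distr M T Y)"
proof -
  have [measurable]: "random_variable S Z" "random_variable T Y"
    and joint: "distr M S Z \<Otimes>\<^sub>M distr M T Y = distr M (S \<Otimes>\<^sub>M T) (\<lambda>\<omega>. (Z \<omega>, Y \<omega>))"
    using indep unfolding indep_var_distribution_eq by auto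
  interpret Z: prob_space "distr M S Z" by (rule prob_space_distr) measurable
  interpret Y: prob_space "distr M T Y" by (rule prob_space_distr) measurable
  interpret pair_sigma_finite "distr M S Z" "distr M T Y" ..
  have int_joint: "integrable (distr M S Z \<Otimes>\<^sub>M distr M T Y) f"
    unfolding joint using integrable_f by (simp add: integrable_distr_eq)
  have [measurable]: "(\<lambda>z. \<integral>y. f (z, y) \<partial>distr M T Y) \<in> borel_measurable S"
    using borel_measurable_integrable[OF integrable_fst'[OF int_joint]] by simp
  show "integrable M (\<lambda>\<omega>. \<integral>y. f (Z \<omega>, y) \<partial>distr M T Y)"
    using integrable_fst'[OF int_joint] by (simp add: integrable_distr_eq)
  have "expectation (\<lambda>\<omega>. f (Z \<omega>, Y \<omega>)) = integral\<^sup>L (distr M S Z \<Otimes>\<^sub>M distr M T Y) f"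
    unfolding joint by (simp add: integral_distr)
  also have "\<dots> = (\<integral>z. \<integral>y. f (z, y) \<partial>distr M T Y \<partial>distr M S Z)"
    using integral_fst'[OF int_joint] by simp
  also have "\<dots> = expectation (\<lambda>\<omega>. \<integral>y. f (Z \<omega>, y) \<partial>distr M T Y)"
    by (simp add: integral_distr)
  finally show "expectation (\<lambda>\<omega>. f (Z \<omega>, Y \<omega>)) = expectation (\<lambda>\<omega>. \<integral>y. f (Z \<omega>, y) \<partial>distr M T Y)" .
qed

section \<open>Selection from independent uniform items\<close>

locale uniform_items = prob_space M for M :: "'a measure" +
  fixes X :: "nat \<Rightarrow> 'a \<Rightarrow> real" and n :: nat
  assumes indep_items: "indep_vars (\<lambda>_. borel) X {1..n}"
    and distr_item: "\<And>i. i \<in> {1..n} \<Longrightarrow> distr M borel (X i) = unit_uniform"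
begin

abbreviation items_until :: "nat \<Rightarrow> 'a measure" where
  "items_until i \<equiv> item_filtration M X n (enat i)"

lemma item_rv [measurable]: "i \<in> {1..n} \<Longrightarrow> X i \<in> borel_measurable M"
  using indep_items by (auto simp: indep_vars_def)

lemma item_filtration_eq:
  "item_filtration M X n t = sigma (space M)
     (\<Union>i\<in>{i \<in> {1..n}. enat i \<le> t}. {X i -` A \<inter> space M | A. A \<in> sets borel})"
  unfolding item_filtration_def by (rule arg_cong2[where f = sigma]) blast+

sublocale filtration "space M" "item_filtration M X n"
proof
  fix s t :: enat
  show "space (item_filtration M X n t) = space M"
    by (simp add: item_filtration_def space_measure_of_conv)
  assume "s \<le> t"
  then show "sets (item_filtration M X n s) \<subseteq> sets (item_filtration M X n t)"
    unfolding item_filtration_def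
    by (subst (1 2) sets_measure_of) (auto intro!: sigma_sets_mono' intro: order_trans)
qed

lemma subalgebra_item_filtration: "subalgebra M (item_filtration M X n t)"
proof -
  have "sets (item_filtration M X n t) \<subseteq> events"
    unfolding item_filtration_def
    by (subst sets_measure_of) (auto intro!: sets.sigma_sets_subset measurable_sets item_rv)
  then show ?thesis by (simp add: subalgebra_def space_F)
qed

lemma measurable_items_until_Suc:
  assumes "f \<in> measurable (items_until i) N" shows "f \<in> measurable (items_until (Suc i)) N"
proof (rule measurable_from_subalg[OF _ assms])
  show "subalgebra (items_until (Suc i)) (items_until i)"
    by (simp add: subalgebra_def space_F sets_F_mono)
qed

lemma item_measurable_items_until:
  assumes "i \<in> {1..n}" shows "X i \<in> borel_measurable (items_until i)"
  using assms unfolding item_filtration_def measurable_def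
  by (subst sets_measure_of) (auto simp: space_measure_of_conv intro!: sigma_sets.Basic)

lemma indep_next_item:
  assumes "Suc i \<le> n" and Z: "Z \<in> borel_measurable (items_until i)"
  shows "indep_var borel Z borel (X (Suc i))"
proof (rule indep_var_sigma_vimage[OF indep_items, where J = "{1..i}"])
  have "{j \<in> {1..n}. enat j \<le> enat i} = {1..i}" using assms(1) by auto
  then show "Z \<in> measurable
      (sigma (space M) (\<Union>j\<in>{1..i}. {X j -` A \<inter> space M | A. A \<in> sets borel})) borel"
    using Z unfolding item_filtration_eq by simp
qed (use assms(1) in auto)

lemma AE_items: "AE \<omega> in M. \<forall>i\<in>{1..n}. X i \<omega> \<in> {0..1}"
proof (rule AE_finite_allI)
  fix i assume "i \<in> {1..n}"
  then show "AE \<omega> in M. X i \<omega> \<in> {0..1}"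
    using AE_unit_uniform AE_distrD[OF item_rv, of i "\<lambda>x. x \<in> {0..1}"] by (simp only: distr_item)
qed simp

definition adapted_selection :: "(nat \<Rightarrow> 'a \<Rightarrow> bool) \<Rightarrow> bool" where
  "adapted_selection S \<longleftrightarrow> (\<forall>i\<in>{1..n}. Measurable.pred (items_until i) (S i))"

primrec last_accepted :: "(nat \<Rightarrow> 'a \<Rightarrow> bool) \<Rightarrow> nat \<Rightarrow> 'a \<Rightarrow> real" where
  "last_accepted S 0 \<omega> = 0"
| "last_accepted S (Suc i) \<omega> = (if S (Suc i) \<omega> then X (Suc i) \<omega> else last_accepted S i \<omega>)"

definition num_accepted :: "(nat \<Rightarrow> 'a \<Rightarrow> bool) \<Rightarrow> nat \<Rightarrow> 'a \<Rightarrow> real" where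
  "num_accepted S i \<omega> = (\<Sum>j<i. of_bool (S (Suc j) \<omega>))"

definition value_process :: "(nat \<Rightarrow> 'a \<Rightarrow> bool) \<Rightarrow> (real \<Rightarrow> real) \<Rightarrow> nat \<Rightarrow> 'a \<Rightarrow> real" where
  "value_process S V i \<omega> = num_accepted S i \<omega> + V (last_accepted S i \<omega>)"

lemma last_accepted_measurable:
  assumes "adapted_selection S" "i \<le> n"
  shows "last_accepted S i \<in> borel_measurable (items_until i)"
  using assms(2)
proof (induction i)
  case (Suc i)
  have [measurable]: "last_accepted S i \<in> borel_measurable (items_until (Suc i))"
    using Suc by (intro measurable_items_until_Suc) auto
  have [measurable]: "Measurable.pred (items_until (Suc i)) (S (Suc i))"
    "X (Suc i) \<in> borel_measurable (items_until (Suc i))"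
    using Suc.prems assms(1) item_measurable_items_until by (auto simp: adapted_selection_def)
  show ?case by simp
next
  case 0
  show ?case unfolding last_accepted.simps(1)[abs_def] by simp
qed

lemma last_accepted_unit:
  assumes "\<forall>i\<in>{1..n}. X i \<omega> \<in> {0..1}" "i \<le> n"
  shows "last_accepted S i \<omega> \<in> {0..1}"
  using assms by (induction i) auto

lemma AE_last_accepted: "i \<le> n \<Longrightarrow> AE \<omega> in M. last_accepted S i \<omega> \<in> {0..1}"
  using AE_items by eventually_elim (rule last_accepted_unit)

lemma AE_last_accepted_mono:
  assumes "i \<le> n" "\<And>z. z \<in> {0..1} \<Longrightarrow> f z \<le> g z"
  shows "AE \<omega> in M. f (last_accepted S i \<omega>) \<le> g (last_accepted S i \<omega>)"
  using AE_last_accepted[OF assms(1)] by eventually_elim (rule assms(2))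

lemma integrable_num_accepted:
  assumes "adapted_selection S" "i \<le> n"
  shows "integrable M (num_accepted S i)"
  unfolding num_accepted_def[abs_def]
proof (rule Bochner_Integration.integrable_sum)
  fix j assume "j \<in> {..<i}"
  then have [measurable]: "Measurable.pred M (S (Suc j))"
    using assms
    by (intro measurable_from_subalg[OF subalgebra_item_filtration[of "enat (Suc j)"]])
      (auto simp: adapted_selection_def)
  show "integrable M (\<lambda>\<omega>. of_bool (S (Suc j) \<omega>) :: real)"
    by (rule integrable_const_bound[where B = 1]) auto
qed

lemma integrable_last_accepted:
  assumes "adapted_selection S" "i \<le> n" and V: "bounded_measurable V"
  shows "integrable M (\<lambda>\<omega>. V (last_accepted S i \<omega>))"
proof -
  obtain B where B: "\<forall>z\<in>{0..1}. \<bar>V z\<bar> \<le> B" using bounded_measurableD(2)[OF V] by blast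
  note [measurable] = bounded_measurableD(1)[OF V]
    measurable_from_subalg[OF subalgebra_item_filtration last_accepted_measurable[OF assms(1,2)]]
  show ?thesis
  proof (rule integrable_const_bound[where B = B])
    show "AE \<omega> in M. norm (V (last_accepted S i \<omega>)) \<le> B"
      using AE_last_accepted[OF assms(2)] by eventually_elim (use B in auto)
  qed measurable
qed

lemma expectation_value_process:
  assumes "adapted_selection S" "i \<le> n" "bounded_measurable V"
  shows "integrable M (value_process S V i)"
    and "expectation (value_process S V i)
      = expectation (num_accepted S i) + expectation (\<lambda>\<omega>. V (last_accepted S i \<omega>))"
  unfolding value_process_def[abs_def]
  using integrable_num_accepted[OF assms(1,2)] integrable_last_accepted[OF assms] by auto

lemma value_process_Suc:
  "value_process S V (Suc i) \<omega> =
   num_accepted S i \<omega> + decision_value (\<lambda>_ _. S (Suc i) \<omega>) V (last_accepted S i \<omega>) (X (Suc i) \<omega>)"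
  by (simp add: value_process_def num_accepted_def decision_value_def)

lemma expectation_decision_value:
  assumes S: "adapted_selection S" and i: "Suc i \<le> n"
    and A: "measurable_rule A" and V: "bounded_measurable V"
  shows "integrable M (\<lambda>\<omega>. decision_value A V (last_accepted S i \<omega>) (X (Suc i) \<omega>))"
    and "integrable M (\<lambda>\<omega>. bellman A V (last_accepted S i \<omega>))"
    and "expectation (\<lambda>\<omega>. decision_value A V (last_accepted S i \<omega>) (X (Suc i) \<omega>))
      = expectation (\<lambda>\<omega>. bellman A V (last_accepted S i \<omega>))"
proof -
  let ?f = "\<lambda>(z, x). decision_value A V z x"
  note f = decision_value_measurable[OF A bounded_measurableD(1)[OF V]]
  have Z: "last_accepted S i \<in> borel_measurable (items_until i)"
    using S i by (intro last_accepted_measurable) auto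
  have [measurable]: "last_accepted S i \<in> borel_measurable M" "X (Suc i) \<in> borel_measurable M"
    "?f \<in> borel_measurable (borel \<Otimes>\<^sub>M borel)"
    using measurable_from_subalg[OF subalgebra_item_filtration Z] item_rv i f by auto
  obtain B where B: "\<forall>z\<in>{0..1}. \<forall>x\<in>{0..1}. \<bar>decision_value A V z x\<bar> \<le> B"
    using decision_value_bounded[OF V] by blast
  have integrable_f: "integrable M (\<lambda>\<omega>. ?f (last_accepted S i \<omega>, X (Suc i) \<omega>))"
  proof (rule integrable_const_bound[where B = B])
    show "AE \<omega> in M. norm (?f (last_accepted S i \<omega>, X (Suc i) \<omega>)) \<le> B"
      using AE_items AE_last_accepted[of i S] i by (auto elim!: eventually_elim2 simp: B)
  qed measurable
  then show "integrable M (\<lambda>\<omega>. decision_value A V (last_accepted S i \<omega>) (X (Suc i) \<omega>))" by simp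
  have "distr M borel (X (Suc i)) = unit_uniform" using i by (intro distr_item) auto
  with expectation_indep_var[OF indep_next_item[OF i Z] f integrable_f]
  show "integrable M (\<lambda>\<omega>. bellman A V (last_accepted S i \<omega>))"
    "expectation (\<lambda>\<omega>. decision_value A V (last_accepted S i \<omega>) (X (Suc i) \<omega>))
      = expectation (\<lambda>\<omega>. bellman A V (last_accepted S i \<omega>))"
    by (simp_all add: bellman_def)
qed

lemma expectation_value_process_step_le:
  assumes S: "adapted_selection S" and i: "Suc i \<le> n"
    and V: "bounded_measurable V" and W: "bounded_measurable W"
    and increasing: "AE \<omega> in M. S (Suc i) \<omega> \<longrightarrow> last_accepted S i \<omega> \<le> X (Suc i) \<omega>"
    and bellman_le: "\<And>z. z \<in> {0..1} \<Longrightarrow> bellman (greedy_rule V) V z \<le> W z"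
  shows "expectation (value_process S V (Suc i)) \<le> expectation (value_process S W i)"
proof -
  let ?Z = "last_accepted S i" and ?N = "num_accepted S i" and ?A = "greedy_rule V"
  have "i \<le> n" using i by simp
  note greedy = expectation_decision_value[OF S i measurable_rule_greedy[OF V] V]
  note int_N = integrable_num_accepted[OF S \<open>i \<le> n\<close>]
  have "expectation (value_process S V (Suc i))
      \<le> expectation (\<lambda>\<omega>. ?N \<omega> + decision_value ?A V (?Z \<omega>) (X (Suc i) \<omega>))"
  proof (rule integral_mono_AE)
    show "AE \<omega> in M. value_process S V (Suc i) \<omega>
        \<le> ?N \<omega> + decision_value ?A V (?Z \<omega>) (X (Suc i) \<omega>)"
      using increasing
      by eventually_elim (simp add: value_process_Suc decision_value_le_greedy)
  qed (use int_N greedy expectation_value_process[OF S i V] in auto)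
  also have "\<dots> = expectation ?N + expectation (\<lambda>\<omega>. bellman ?A V (?Z \<omega>))"
    using int_N greedy by simp
  also have "expectation (\<lambda>\<omega>. bellman ?A V (?Z \<omega>)) \<le> expectation (\<lambda>\<omega>. W (?Z \<omega>))"
    by (intro integral_mono_AE greedy integrable_last_accepted[OF S \<open>i \<le> n\<close> W]
        AE_last_accepted_mono[OF \<open>i \<le> n\<close>] bellman_le)
  finally show ?thesis by (simp add: expectation_value_process[OF S \<open>i \<le> n\<close> W])
qed

lemma expectation_value_process_step_ge:
  assumes S: "adapted_selection S" and i: "Suc i \<le> n" and A: "measurable_rule A"
    and V: "bounded_measurable V" and W: "bounded_measurable W"
    and rule: "\<And>\<omega>. S (Suc i) \<omega> \<longleftrightarrow> A (last_accepted S i \<omega>) (X (Suc i) \<omega>)"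
    and bellman_ge: "\<And>z. z \<in> {0..1} \<Longrightarrow> W z \<le> bellman A V z"
  shows "expectation (value_process S W i) \<le> expectation (value_process S V (Suc i))"
proof -
  let ?Z = "last_accepted S i" and ?N = "num_accepted S i"
  have "i \<le> n" using i by simp
  note decision = expectation_decision_value[OF S i A V]
  note int_N = integrable_num_accepted[OF S \<open>i \<le> n\<close>]
  have "expectation (\<lambda>\<omega>. W (?Z \<omega>)) \<le> expectation (\<lambda>\<omega>. bellman A V (?Z \<omega>))"
    by (intro integral_mono_AE decision integrable_last_accepted[OF S \<open>i \<le> n\<close> W]
        AE_last_accepted_mono[OF \<open>i \<le> n\<close>] bellman_ge)
  then have "expectation (value_process S W i)
      \<le> expectation ?N + expectation (\<lambda>\<omega>. bellman A V (?Z \<omega>))"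
    by (simp add: expectation_value_process[OF S \<open>i \<le> n\<close> W])
  also have "\<dots> = expectation (\<lambda>\<omega>. ?N \<omega> + decision_value A V (?Z \<omega>) (X (Suc i) \<omega>))"
    using int_N decision by simp
  also have "(\<lambda>\<omega>. ?N \<omega> + decision_value A V (?Z \<omega>) (X (Suc i) \<omega>)) = value_process S V (Suc i)"
    by (simp add: fun_eq_iff value_process_Suc decision_value_def rule)
  finally show ?thesis .
qed

lemma expectation_value_process_0: "expectation (value_process S V 0) = V 0"
  by (simp add: value_process_def[abs_def] num_accepted_def prob_space)

lemma expectation_num_accepted_le_supersolution:
  assumes S: "adapted_selection S" and V: "supersolution V"
    and increasing: "AE \<omega> in M. \<forall>i<n. S (Suc i) \<omega> \<longrightarrow> last_accepted S i \<omega> \<le> X (Suc i) \<omega>"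
  shows "expectation (num_accepted S n) \<le> V n 0"
proof -
  have bounded: "bounded_measurable (V k)" for k using V by (simp add: supersolution_def)
  have "expectation (value_process S (V (n - i)) i) \<le> V n 0" if "i \<le> n" for i
    using that
  proof (induction i)
    case (Suc i)
    then obtain k where k: "n - i = Suc k" "n - Suc i = k" by (cases "n - i") auto
    have "expectation (value_process S (V k) (Suc i))
        \<le> expectation (value_process S (V (Suc k)) i)"
      using S V Suc.prems increasing bounded
      by (intro expectation_value_process_step_le)
        (auto simp: supersolution_def elim!: eventually_mono)
    also have "\<dots> \<le> V n 0" using Suc k by simp
    finally show ?case by (simp add: k)
  qed (simp add: expectation_value_process_0)
  from this[of n] have "expectation (value_process S (V 0) n) \<le> V n 0" by simp
  moreover have "expectation (num_accepted S n) \<le> expectation (value_process S (V 0) n)"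
    using AE_last_accepted_mono[of n "\<lambda>_. 0" "V 0" S] V
    by (intro integral_mono_AE integrable_num_accepted expectation_value_process S bounded)
      (auto simp: value_process_def supersolution_def)
  ultimately show ?thesis by simp
qed

lemma expectation_num_accepted_ge_subsolution:
  assumes S: "adapted_selection S" and V: "subsolution A V" and A: "\<And>k. measurable_rule (A k)"
    and rule: "\<And>i \<omega>. i < n \<Longrightarrow> S (Suc i) \<omega> \<longleftrightarrow> A (n - i) (last_accepted S i \<omega>) (X (Suc i) \<omega>)"
  shows "V n 0 \<le> expectation (num_accepted S n)"
proof -
  have bounded: "bounded_measurable (V k)" for k using V by (simp add: subsolution_def)
  have "V n 0 \<le> expectation (value_process S (V (n - i)) i)" if "i \<le> n" for i
    using that
  proof (induction i)
    case (Suc i)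
    then obtain k where k: "n - i = Suc k" "n - Suc i = k" by (cases "n - i") auto
    have "V n 0 \<le> expectation (value_process S (V (Suc k)) i)" using Suc k by simp
    also have "\<dots> \<le> expectation (value_process S (V k) (Suc i))"
      using S V Suc.prems bounded A rule[of i] k(1)
      by (intro expectation_value_process_step_ge[where A = "A (Suc k)"])
        (auto simp: subsolution_def)
    finally show ?case by (simp add: k)
  qed (simp add: expectation_value_process_0)
  from this[of n] have "V n 0 \<le> expectation (value_process S (V 0) n)" by simp
  also have "\<dots> \<le> expectation (num_accepted S n)"
    using AE_last_accepted_mono[of n "V 0" "\<lambda>_. 0" S] V
    by (intro integral_mono_AE integrable_num_accepted expectation_value_process S bounded)
      (auto simp: value_process_def subsolution_def)
  finally show ?thesis .
qed

subsection \<open>The heuristic policy\<close>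

definition heuristic_accepts :: "nat \<Rightarrow> 'a \<Rightarrow> bool" where
  "heuristic_accepts i \<omega> \<longleftrightarrow>
     accepts (n - (i - 1)) (last_selected n (\<lambda>i. X i \<omega>) (i - 1)) (X i \<omega>)"

lemma last_accepted_heuristic:
  "last_accepted heuristic_accepts i \<omega> = last_selected n (\<lambda>i. X i \<omega>) i"
  by (induction i) (auto simp: heuristic_accepts_def)

lemma heuristic_accepts_Suc:
  "heuristic_accepts (Suc i) \<omega> \<longleftrightarrow>
     accepts (n - i) (last_accepted heuristic_accepts i \<omega>) (X (Suc i) \<omega>)"
  unfolding last_accepted_heuristic by (simp add: heuristic_accepts_def)

lemma last_selected_measurable:
  assumes "i \<le> n"
  shows "(\<lambda>\<omega>. last_selected n (\<lambda>i. X i \<omega>) i) \<in> borel_measurable (items_until i)"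
  using assms
proof (induction i)
  case (Suc i)
  have [measurable]: "(\<lambda>\<omega>. last_selected n (\<lambda>i. X i \<omega>) i) \<in> borel_measurable (items_until (Suc i))"
    "X (Suc i) \<in> borel_measurable (items_until (Suc i))"
    using Suc by (auto intro: measurable_items_until_Suc item_measurable_items_until)
  show ?case unfolding last_selected.simps accepts_def by measurable
qed simp

lemma adapted_heuristic: "adapted_selection heuristic_accepts"
  unfolding adapted_selection_def
proof
  fix i assume "i \<in> {1..n}"
  then obtain j where j: "i = Suc j" "Suc j \<le> n" by (cases i) auto
  have [measurable]: "(\<lambda>\<omega>. last_selected n (\<lambda>i. X i \<omega>) j) \<in> borel_measurable (items_until (Suc j))"
    "X (Suc j) \<in> borel_measurable (items_until (Suc j))"
    using j last_selected_measurable[of j]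
    by (auto intro: measurable_items_until_Suc item_measurable_items_until)
  show "Measurable.pred (items_until i) (heuristic_accepts i)"
    unfolding j heuristic_accepts_def[abs_def] accepts_def by (simp, measurable)
qed

lemma num_accepted_heuristic:
  "num_accepted heuristic_accepts n \<omega> = real (heuristic_length n (\<lambda>i. X i \<omega>))"
proof -
  have "{i. i < n \<and> accepts (n - i) (last_selected n (\<lambda>i. X i \<omega>) i) (X (Suc i) \<omega>)} =
     {..<n} \<inter> {i. heuristic_accepts (Suc i) \<omega>}"
    by (auto simp: heuristic_accepts_def)
  then show ?thesis
    by (simp add: num_accepted_def heuristic_length_def sum_of_bool_eq)
qed

lemma heuristic_value_ge_subsolution:
  assumes "subsolution accepts V" shows "V n 0 \<le> heuristic_value M X n"
  using expectation_num_accepted_ge_subsolution[OF adapted_heuristic assms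
      measurable_rule_accepts heuristic_accepts_Suc]
  by (simp add: heuristic_value_def num_accepted_heuristic[abs_def])

subsection \<open>Arbitrary online policies\<close>

definition policy_selects :: "(nat \<Rightarrow> 'a \<Rightarrow> enat) \<Rightarrow> nat \<Rightarrow> 'a \<Rightarrow> bool" where
  "policy_selects \<tau> i \<omega> \<longleftrightarrow> (\<exists>j\<in>{1..}. \<tau> j \<omega> = enat i)"

lemma adapted_policy:
  assumes "online_policy M X n \<tau>" shows "adapted_selection (policy_selects \<tau>)"
  unfolding adapted_selection_def policy_selects_def[abs_def]
proof
  fix i
  have "stopping_time (item_filtration M X n) (\<tau> j)" if "j \<in> {1..}" for j
    using assms that by (auto simp: online_policy_def)
  then show "Measurable.pred (items_until i) (\<lambda>\<omega>. \<exists>j\<in>{1..}. \<tau> j \<omega> = enat i)"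
    by (intro pred_intros_countable_bounded stopping_time_eq_const) auto
qed

lemma online_policyD:
  assumes "online_policy M X n \<tau>" "\<omega> \<in> space M" "1 \<le> j"
  shows "\<tau> j \<omega> \<in> insert \<infinity> (enat ` {1..n})"
    and "\<tau> (Suc j) \<omega> \<noteq> \<infinity> \<Longrightarrow> \<tau> j \<omega> < \<tau> (Suc j) \<omega>"
    and "\<tau> (Suc j) \<omega> \<noteq> \<infinity> \<Longrightarrow> X (the_enat (\<tau> j \<omega>)) \<omega> < X (the_enat (\<tau> (Suc j) \<omega>)) \<omega>"
proof -
  note policy = conjunct2[OF assms(1)[unfolded online_policy_def], rule_format, OF assms(3,2)]
  show "\<tau> j \<omega> \<in> insert \<infinity> (enat ` {1..n})"
    using policy by (rule conjunct1)
  show "\<tau> j \<omega> < \<tau> (Suc j) \<omega>" if "\<tau> (Suc j) \<omega> \<noteq> \<infinity>"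
    using conjunct1[OF conjunct2[OF policy]] that by metis
  show "X (the_enat (\<tau> j \<omega>)) \<omega> < X (the_enat (\<tau> (Suc j) \<omega>)) \<omega>" if "\<tau> (Suc j) \<omega> \<noteq> \<infinity>"
    using conjunct2[OF conjunct2[OF policy]] that by (rule mp)
qed

lemma policy_increasing:
  assumes pol: "online_policy M X n \<tau>" "\<omega> \<in> space M" and "1 \<le> j" "j < j'" "\<tau> j' \<omega> \<noteq> \<infinity>"
  shows "\<tau> j \<omega> < \<tau> j' \<omega> \<and> X (the_enat (\<tau> j \<omega>)) \<omega> < X (the_enat (\<tau> j' \<omega>)) \<omega>"
  using assms(4,5)
proof (induction j')
  case (Suc k)
  then have "1 \<le> k" using \<open>1 \<le> j\<close> by simp
  note Suc_step = online_policyD(2,3)[OF pol this Suc.prems(2)]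
  show ?case
  proof (cases "j = k")
    case False
    moreover have "\<tau> k \<omega> \<noteq> \<infinity>" using Suc_step(1) by (cases "\<tau> k \<omega>") auto
    ultimately have "\<tau> j \<omega> < \<tau> k \<omega> \<and> X (the_enat (\<tau> j \<omega>)) \<omega> < X (the_enat (\<tau> k \<omega>)) \<omega>"
      using Suc.prems by (intro Suc.IH) auto
    then show ?thesis using Suc_step by (auto intro: less_trans)
  qed (use Suc_step in simp)
qed simp

lemma policy_index_le_time:
  assumes pol: "online_policy M X n \<tau>" "\<omega> \<in> space M" and "1 \<le> j"
  shows "enat j \<le> \<tau> j \<omega>"
  using \<open>1 \<le> j\<close>
proof (induction j rule: dec_induct)
  case base
  show ?case using online_policyD(1)[OF pol order_refl] by auto
next
  case (step j)
  show ?case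
  proof (cases "\<tau> (Suc j) \<omega> = \<infinity>")
    case False
    then have "\<tau> j \<omega> < \<tau> (Suc j) \<omega>" using online_policyD(2)[OF pol] step by simp
    with step.IH have "enat j < \<tau> (Suc j) \<omega>" by (rule le_less_trans)
    then show ?thesis by (cases "\<tau> (Suc j) \<omega>") auto
  qed simp
qed

text \<open>Quantifying over all later selections makes the statement inductive in \<open>i\<close>.\<close>

lemma last_accepted_policy_le:
  assumes pol: "online_policy M X n \<tau>" "\<omega> \<in> space M" and unit: "\<forall>i\<in>{1..n}. X i \<omega> \<in> {0..1}"
    and "policy_selects \<tau> t \<omega>" "i < t" "t \<le> n"
  shows "last_accepted (policy_selects \<tau>) i \<omega> \<le> X t \<omega>"
  using assms(4-6)
proof (induction i)
  case 0
  then show ?case using unit by auto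
next
  case (Suc i)
  show ?case
  proof (cases "policy_selects \<tau> (Suc i) \<omega>")
    case True
    then obtain j j' where j: "1 \<le> j" "\<tau> j \<omega> = enat (Suc i)" "1 \<le> j'" "\<tau> j' \<omega> = enat t"
      using Suc.prems by (auto simp: policy_selects_def)
    have "j < j'"
    proof (rule ccontr)
      assume "\<not> j < j'"
      then consider "j = j'" | "j' < j" by linarith
      then show False
        using policy_increasing[OF pol j(3), of j] j Suc.prems by cases auto
    qed
    from policy_increasing[OF pol j(1) this] j True show ?thesis by simp
  qed (use Suc in auto)
qed

lemma selected_length_le_num_accepted:
  assumes pol: "online_policy M X n \<tau>" "\<omega> \<in> space M"
  shows "real (selected_length n \<tau> \<omega>) \<le> num_accepted (policy_selects \<tau>) n \<omega>"
proof -
  let ?J = "{j. 1 \<le> j \<and> \<tau> j \<omega> \<le> enat n}" and ?T = "{..<n} \<inter> {i. policy_selects \<tau> (Suc i) \<omega>}"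
  define k where "k = selected_length n \<tau> \<omega>"
  define idx where "idx j = the_enat (\<tau> j \<omega>) - 1" for j
  have "j \<le> n" if "j \<in> ?J" for j
    using order_trans[OF policy_index_le_time[OF pol, of j], of "enat n"] that by simp
  then have "?J \<subseteq> {..n}" by blast
  then have "finite ?J" by (rule finite_subset) simp
  then have "k \<in> insert 0 ?J" unfolding k_def selected_length_def by (intro Max_in) auto
  have le_n: "\<tau> j \<omega> \<le> enat n" if "j \<in> {1..k}" for j
  proof -
    have le_n: "\<tau> k \<omega> \<le> enat n" using that \<open>k \<in> insert 0 ?J\<close> by auto
    then have "\<tau> k \<omega> \<noteq> \<infinity>" by (cases "\<tau> k \<omega>") auto
    then have "\<tau> j \<omega> \<le> \<tau> k \<omega>"
      using policy_increasing[OF pol, of j k] that by (cases "j = k") auto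
    then show ?thesis using le_n by (rule order_trans)
  qed
  have idx: "\<tau> j \<omega> = enat (Suc (idx j))" "idx j < n" if "j \<in> {1..k}" for j
    using online_policyD(1)[OF pol, of j] le_n[OF that] that by (auto simp: idx_def)
  have "idx i < idx j" if "i \<in> {1..k}" "j \<in> {1..k}" "i < j" for i j
    using policy_increasing[OF pol, of i j] idx[OF that(1)] idx[OF that(2)] that by auto
  then have "inj_on idx {1..k}" by (intro linorder_inj_onI') (metis less_irrefl)
  moreover have "idx ` {1..k} \<subseteq> ?T" using idx by (force simp: policy_selects_def)
  ultimately have "card {1..k} \<le> card ?T" by (rule card_inj_on_le) simp
  then show ?thesis by (simp add: k_def num_accepted_def sum_of_bool_eq)
qed

lemma policy_value_le_supersolution:
  assumes pol: "online_policy M X n \<tau>" and V: "supersolution V"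
  shows "expectation (\<lambda>\<omega>. real (selected_length n \<tau> \<omega>)) \<le> V n 0"
proof -
  let ?S = "policy_selects \<tau>"
  have "expectation (\<lambda>\<omega>. real (selected_length n \<tau> \<omega>)) \<le> expectation (num_accepted ?S n)"
  proof (rule integral_mono_AE')
    show "integrable M (num_accepted ?S n)"
      using adapted_policy[OF pol] by (rule integrable_num_accepted) simp
    show "AE \<omega> in M. real (selected_length n \<tau> \<omega>) \<le> num_accepted ?S n \<omega>"
      using AE_space by eventually_elim (rule selected_length_le_num_accepted[OF pol])
  qed (simp add: num_accepted_def sum_nonneg)
  also have "\<dots> \<le> V n 0"
  proof (rule expectation_num_accepted_le_supersolution[OF adapted_policy[OF pol] V])
    show "AE \<omega> in M. \<forall>i<n. ?S (Suc i) \<omega> \<longrightarrow> last_accepted ?S i \<omega> \<le> X (Suc i) \<omega>"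
      using AE_items AE_space by eventually_elim (auto intro: last_accepted_policy_le[OF pol])
  qed
  finally show ?thesis .
qed

lemma optimal_value_le_supersolution:
  assumes "supersolution V" shows "optimal_value M X n \<le> V n 0"
  unfolding optimal_value_def
proof (rule cSUP_least)
  have "online_policy M X n (\<lambda>_ _. \<infinity>)"
    by (auto simp: online_policy_def stopping_time_def)
  then show "{\<tau>. online_policy M X n \<tau>} \<noteq> {}" by blast
qed (use assms in \<open>auto intro: policy_value_le_supersolution\<close>)

end

theorem mainTheorem2:
  fixes M :: "nat \<Rightarrow> 'a measure" and X :: "nat \<Rightarrow> nat \<Rightarrow> 'a \<Rightarrow> real"
  assumes "\<And>n. n \<ge> 1 \<Longrightarrow> prob_space (M n)"
    and "\<And>n. n \<ge> 1 \<Longrightarrow> prob_space.indep_vars (M n) (\<lambda>_. borel) (X n) {1..n}"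
    and "\<And>n i. n \<ge> 1 \<Longrightarrow> i \<in> {1..n} \<Longrightarrow>
           distr (M n) borel (X n i) = uniform_measure lborel {0..1}"
  shows "(SUP n\<in>{1..}. ereal (optimal_value (M n) (X n) n - heuristic_value (M n) (X n) n)) < \<infinity>"
proof -
  obtain C D where super: "supersolution (upper_value C)"
    and sub: "subsolution accepts (lower_value D)"
    using ex_supersolution ex_subsolution by blast
  have "optimal_value (M n) (X n) n - heuristic_value (M n) (X n) n \<le> C + D" if "n \<ge> 1" for n
  proof -
    interpret uniform_items "M n" "X n" n
      unfolding uniform_items_def uniform_items_axioms_def using assms that by blast
    show ?thesis
      using optimal_value_le_supersolution[OF super] heuristic_value_ge_subsolution[OF sub]
        upper_minus_lower_value[of C n 0 D] by linarith
  qed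
  then have "(SUP n\<in>{1..}. ereal (optimal_value (M n) (X n) n - heuristic_value (M n) (X n) n))
      \<le> ereal (C + D)"
    by (intro SUP_least) auto
  then show ?thesis by (rule le_less_trans) simp
qed

end
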